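(* If $\mathcal{G}$ is a model of $\phi_{\mathcal{F}}$, then $(V(\mathcal{G}),\triangleleft)$ is a dense linear ordering with character $\chi(V(\mathcal{G}),\triangleleft)=cf(M(\mathcal{G}),<)$.
   Context: Let $\lambda$ be an uncountable cardinal and $\mathcal{M}$ a countable structure in a countable language $\mathcal{L}_0$ containing $<$, where $<$ is a dense linear ordering on $\mathcal{M}$, whose Scott sentence $\phi$ characterizes $\lambda$ (has a model of cardinality $\lambda$ and none of cardinality $\lambda^+$). Let $\mathcal{L}$ extend $\mathcal{L}_0$ by unary predicates $V,M,N$, a binary relation $\triangleleft$ and a binary function symbol $f$. $K(\mathcal{M})$ is the class of countable $\mathcal{L}$-structures $\mathcal{A}$ such that: (1) $V(\mathcal{A}),M(\mathcal{A})$ partition the universe, $V(\mathcal{A})$ is finite and $M(\mathcal{A})$ (with its $\mathcal{L}_0$-structure) is $\mathcal{M}$; (2) $\triangleleft$ is a linear order on $V(\mathcal{A})$; (3) for $x\ne y$ in $V(\mathcal{A})$, $f(x,y)=f(y,x)\in M(\mathcal{A})$; (4) if $x\triangleleft y\triangleleft z$ are distinct elements of $V(\mathcal{A})$, then either $f(x,y)=f(x,z)=f(y,z)$, or $f(x,y)=f(x,z)<f(y,z)$, or $f(x,z)=f(y,z)<f(x,y)$; (5) $N(x)$ implies $x\in V(\mathcal{A})$. A finitely generated$/\mathcal{M}$ substructure of a structure containing $\mathcal{M}$ is one of the form $\langle A_0\rangle\cup\mathcal{M}$, $A_0$ finite. $\mathcal{F}$ is the Fraïssé limit of $K(\mathcal{M})$: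 the (unique up to isomorphism) countable $\mathcal{L}$-structure containing $\mathcal{M}$ whose finitely generated$/\mathcal{M}$ substructures are, up to isomorphism, exactly the members of $K(\mathcal{M})$ and in which every isomorphism between finitely generated$/\mathcal{M}$ substructures extends to an automorphism; $\phi_{\mathcal{F}}$ is its Scott sentence. For a linear order $(L,<)$ and $m\in L$, the left (right) character of $m$ is the least cardinal admitting a cofinal map into $\{n:n<m\}$ (coinitial map into $\{n:n>m\}$); $\chi(m)$ is the smaller of the two and $\chi(L,<)=\min_{m\in L}\chi(m)$.
   Formalization: The ordering < on M is additionally assumed to have no last element (otherwise cf(M)=1 while χ(V) is infinite, so the claim fails); symbols are given trivial values outside their intended domains so that the limit of K(M) exists. *)

theory Defs
  imports Complex_Main "HOL-Library.Countable_Set"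
begin

unbundle cardinal_syntax

section \<open>Structures\<close>

record ('f, 'r) lang =
  Fsyms :: "'f set"
  Rsyms :: "'r set"
  farity :: "'f \<Rightarrow> nat"
  rarity :: "'r \<Rightarrow> nat"

definition countable_lang :: "('f, 'r) lang \<Rightarrow> bool" where
  "countable_lang L \<longleftrightarrow> countable (Fsyms L) \<and> countable (Rsyms L)"

text \<open>Only the values of \<open>fint\<close> and \<open>rint\<close> at symbols of the language and at tuples of the right
  length from \<open>univ\<close> are meaningful; no definition below inspects any others.\<close>

record ('a, 'f, 'r) struct =
  univ :: "'a set"
  fint :: "'f \<Rightarrow> 'a list \<Rightarrow> 'a"
  rint :: "'r \<Rightarrow> 'a list \<Rightarrow> bool"

definition tuples :: "'a set \<Rightarrow> nat \<Rightarrow> 'a list set" where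
  "tuples A n = {xs. set xs \<subseteq> A \<and> length xs = n}"

definition is_structure :: "('f, 'r) lang \<Rightarrow> ('a, 'f, 'r) struct \<Rightarrow> bool" where
  "is_structure L S \<longleftrightarrow> univ S \<noteq> {} \<and>
     (\<forall>g\<in>Fsyms L. \<forall>xs\<in>tuples (univ S) (farity L g). fint S g xs \<in> univ S)"

definition isomorphism ::
    "('f, 'r) lang \<Rightarrow> ('a, 'f, 'r) struct \<Rightarrow> ('b, 'f, 'r) struct \<Rightarrow> ('a \<Rightarrow> 'b) \<Rightarrow> bool" where
  "isomorphism L S T h \<longleftrightarrow>
     is_structure L S \<and> is_structure L T \<and> bij_betw h (univ S) (univ T) \<and>
     (\<forall>g\<in>Fsyms L. \<forall>xs\<in>tuples (univ S) (farity L g). h (fint S g xs) = fint T g (map h xs)) \<and>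
     (\<forall>R\<in>Rsyms L. \<forall>xs\<in>tuples (univ S) (rarity L R). rint S R xs \<longleftrightarrow> rint T R (map h xs))"

definition isomorphic ::
    "('f, 'r) lang \<Rightarrow> ('a, 'f, 'r) struct \<Rightarrow> ('b, 'f, 'r) struct \<Rightarrow> bool" where
  "isomorphic L S T \<longleftrightarrow> (\<exists>h. isomorphism L S T h)"

inductive_set generated :: "('f, 'r) lang \<Rightarrow> ('a, 'f, 'r) struct \<Rightarrow> 'a set \<Rightarrow> 'a set"
  for L :: "('f, 'r) lang" and S :: "('a, 'f, 'r) struct" and A :: "'a set" where
  base: "x \<in> A \<Longrightarrow> x \<in> generated L S A"
| app: "\<lbrakk>g \<in> Fsyms L; length xs = farity L g; \<forall>x\<in>set xs. x \<in> generated L S A\<rbrakk>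
        \<Longrightarrow> fint S g xs \<in> generated L S A"


section \<open>The logic with countable conjunctions and finite quantifier strings\<close>

datatype 'f trm = Var nat | Fn 'f "'f trm list"

datatype ('f, 'r) fm =
    Eq "'f trm" "'f trm"
  | Rel 'r "'f trm list"
  | Neg "('f, 'r) fm"
  | Conj "nat \<Rightarrow> ('f, 'r) fm"
  | Ex nat "('f, 'r) fm"

primrec eval_trm :: "('a, 'f, 'r) struct \<Rightarrow> (nat \<Rightarrow> 'a) \<Rightarrow> 'f trm \<Rightarrow> 'a" where
  "eval_trm S e (Var n) = e n"
| "eval_trm S e (Fn g ts) = fint S g (map (eval_trm S e) ts)"

primrec sat :: "('a, 'f, 'r) struct \<Rightarrow> (nat \<Rightarrow> 'a) \<Rightarrow> ('f, 'r) fm \<Rightarrow> bool" where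
  "sat S e (Eq s t) \<longleftrightarrow> eval_trm S e s = eval_trm S e t"
| "sat S e (Rel R ts) \<longleftrightarrow> rint S R (map (eval_trm S e) ts)"
| "sat S e (Neg \<phi>) \<longleftrightarrow> \<not> sat S e \<phi>"
| "sat S e (Conj \<Phi>) \<longleftrightarrow> (\<forall>n. sat S e (\<Phi> n))"
| "sat S e (Ex n \<phi>) \<longleftrightarrow> (\<exists>a\<in>univ S. sat S (e(n := a)) \<phi>)"

fun wf_trm :: "('f, 'r) lang \<Rightarrow> 'f trm \<Rightarrow> bool" where
  "wf_trm L (Var n) \<longleftrightarrow> True"
| "wf_trm L (Fn g ts) \<longleftrightarrow> g \<in> Fsyms L \<and> length ts = farity L g \<and> (\<forall>t\<in>set ts. wf_trm L t)"

primrec wf_fm :: "('f, 'r) lang \<Rightarrow> ('f, 'r) fm \<Rightarrow> bool" where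
  "wf_fm L (Eq s t) \<longleftrightarrow> wf_trm L s \<and> wf_trm L t"
| "wf_fm L (Rel R ts) \<longleftrightarrow> R \<in> Rsyms L \<and> length ts = rarity L R \<and> (\<forall>t\<in>set ts. wf_trm L t)"
| "wf_fm L (Neg \<phi>) \<longleftrightarrow> wf_fm L \<phi>"
| "wf_fm L (Conj \<Phi>) \<longleftrightarrow> (\<forall>n. wf_fm L (\<Phi> n))"
| "wf_fm L (Ex n \<phi>) \<longleftrightarrow> wf_fm L \<phi>"

fun fv_trm :: "'f trm \<Rightarrow> nat set" where
  "fv_trm (Var n) = {n}"
| "fv_trm (Fn g ts) = (\<Union>t\<in>set ts. fv_trm t)"

primrec fv :: "('f, 'r) fm \<Rightarrow> nat set" where
  "fv (Eq s t) = fv_trm s \<union> fv_trm t"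
| "fv (Rel R ts) = (\<Union>t\<in>set ts. fv_trm t)"
| "fv (Neg \<phi>) = fv \<phi>"
| "fv (Conj \<Phi>) = (\<Union>n. fv (\<Phi> n))"
| "fv (Ex n \<phi>) = fv \<phi> - {n}"

text \<open>A subformula of a sentence lies under only finitely many quantifiers, so it automatically
  has only finitely many free variables.\<close>

definition sentence :: "('f, 'r) lang \<Rightarrow> ('f, 'r) fm \<Rightarrow> bool" where
  "sentence L \<phi> \<longleftrightarrow> wf_fm L \<phi> \<and> fv \<phi> = {}"

definition is_model :: "('f, 'r) lang \<Rightarrow> ('a, 'f, 'r) struct \<Rightarrow> ('f, 'r) fm \<Rightarrow> bool" where
  "is_model L S \<phi> \<longleftrightarrow> is_structure L S \<and> (\<forall>e. range e \<subseteq> univ S \<longrightarrow> sat S e \<phi>)"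

text \<open>The countable models of a Scott sentence of \<open>S\<close> are exactly the isomorphic copies of \<open>S\<close>.
  Every countable structure has an isomorphic copy whose universe is a set of natural numbers,
  so it suffices to let \<open>T\<close> range over those.\<close>

definition scott_sentence ::
    "('f, 'r) lang \<Rightarrow> ('a, 'f, 'r) struct \<Rightarrow> ('f, 'r) fm \<Rightarrow> bool" where
  "scott_sentence L S \<phi> \<longleftrightarrow> sentence L \<phi> \<and>
     (\<forall>T :: (nat, 'f, 'r) struct. is_structure L T \<longrightarrow> (is_model L T \<phi> \<longleftrightarrow> isomorphic L T S))"

text \<open>A structure of cardinality \<open>\<kappa>\<close> (respectively \<open>\<kappa>\<^sup>+\<close>) has an isomorphic copy on the field of
  \<open>\<kappa>\<close> (respectively of \<open>cardSuc \<kappa>\<close>), so the two types of elements below lose no models.\<close>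

definition characterizes :: "('f, 'r) lang \<Rightarrow> ('f, 'r) fm \<Rightarrow> 'c rel \<Rightarrow> bool" where
  "characterizes L \<phi> \<kappa> \<longleftrightarrow>
     (\<exists>S :: ('c, 'f, 'r) struct. is_model L S \<phi> \<and> |univ S| =o \<kappa>) \<and>
     \<not> (\<exists>S :: ('c set, 'f, 'r) struct. is_model L S \<phi> \<and> |univ S| =o cardSuc \<kappa>)"


section \<open>Linear orders, cofinality and character\<close>

text \<open>End points are allowed here. That \<open>M\<close> has no last element is a separate hypothesis of the
  theorem: with a last element the cofinality of \<open>M\<close> would be 1, while characters of points
  of a dense order without end points are infinite.\<close>

definition dense_linear_ordering :: "'a set \<Rightarrow> 'a rel \<Rightarrow> bool" where
  "dense_linear_ordering A r \<longleftrightarrow> A \<noteq> {} \<and> strict_linear_order_on A r \<and>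
     (\<forall>x\<in>A. \<forall>y\<in>A. (x, y) \<in> r \<longrightarrow> (\<exists>z\<in>A. (x, z) \<in> r \<and> (z, y) \<in> r))"

text \<open>Unspecified if no cardinal on the type \<open>'a\<close> satisfies \<open>P\<close>.\<close>

definition least_card :: "('a rel \<Rightarrow> bool) \<Rightarrow> 'a rel" where
  "least_card P = (SOME \<kappa>. Card_order \<kappa> \<and> P \<kappa> \<and> (\<forall>\<mu>. Card_order \<mu> \<and> P \<mu> \<longrightarrow> \<kappa> \<le>o \<mu>))"

definition cofinal_map :: "('i \<Rightarrow> 'a) \<Rightarrow> 'i rel \<Rightarrow> 'a set \<Rightarrow> 'a rel \<Rightarrow> bool" where
  "cofinal_map h \<kappa> A r \<longleftrightarrow> h ` Field \<kappa> \<subseteq> A \<and> (\<forall>a\<in>A. \<exists>i\<in>Field \<kappa>. a = h i \<or> (a, h i) \<in> r)"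

text \<open>The range of a cofinal map is no larger than its index set, so cardinals on the type of the
  elements of \<open>A\<close> suffice.\<close>

definition cofinality :: "'a set \<Rightarrow> 'a rel \<Rightarrow> 'a rel" where
  "cofinality A r = least_card (\<lambda>\<kappa>. \<exists>h :: 'a \<Rightarrow> 'a. cofinal_map h \<kappa> A r)"

definition left_character :: "'a set \<Rightarrow> 'a rel \<Rightarrow> 'a \<Rightarrow> 'a rel" where
  "left_character A r m = cofinality {n\<in>A. (n, m) \<in> r} r"

definition right_character :: "'a set \<Rightarrow> 'a rel \<Rightarrow> 'a \<Rightarrow> 'a rel" where
  "right_character A r m = cofinality {n\<in>A. (m, n) \<in> r} (r\<inverse>)"

definition point_character :: "'a set \<Rightarrow> 'a rel \<Rightarrow> 'a \<Rightarrow> 'a rel" where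
  "point_character A r m =
     least_card (\<lambda>\<kappa>. \<kappa> =o left_character A r m \<or> \<kappa> =o right_character A r m)"

definition character :: "'a set \<Rightarrow> 'a rel \<Rightarrow> 'a rel" where
  "character A r = least_card (\<lambda>\<kappa>. \<exists>m\<in>A. \<kappa> =o point_character A r m)"

lemma least_card:
  assumes "Card_order \<kappa>" "P \<kappa>"
  shows "Card_order (least_card P)" "P (least_card P)"
    "\<And>\<mu>. Card_order \<mu> \<Longrightarrow> P \<mu> \<Longrightarrow> least_card P \<le>o \<mu>"
proof -
  have "\<exists>\<kappa>. Card_order \<kappa> \<and> P \<kappa> \<and> (\<forall>\<mu>. Card_order \<mu> \<and> P \<mu> \<longrightarrow> \<kappa> \<le>o \<mu>)"
    using exists_minim_Card_order[of "{\<kappa>. Card_order \<kappa> \<and> P \<kappa>}"] assms by blast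
  from someI_ex[OF this]
  show "Card_order (least_card P)" "P (least_card P)"
    "\<And>\<mu>. Card_order \<mu> \<Longrightarrow> P \<mu> \<Longrightarrow> least_card P \<le>o \<mu>"
    unfolding least_card_def by auto
qed

lemma cofinality:
  shows "Card_order (cofinality A r)" "\<exists>h :: 'a \<Rightarrow> 'a. cofinal_map h (cofinality A r) A r"
    and "Card_order (\<mu> :: 'i rel) \<Longrightarrow> cofinal_map g \<mu> A r \<Longrightarrow> cofinality A r \<le>o \<mu>"
proof -
  let ?P = "\<lambda>\<kappa>. \<exists>h :: 'a \<Rightarrow> 'a. cofinal_map h \<kappa> A r"
  have id: "\<exists>h :: 'a \<Rightarrow> 'a. cofinal_map h |B| A r"
    if "B \<subseteq> A" "\<forall>a\<in>A. \<exists>b\<in>B. a = b \<or> (a, b) \<in> r" for B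
    using that by (intro exI[of _ id]) (auto simp: cofinal_map_def Field_card_of)
  have ex: "\<exists>h :: 'a \<Rightarrow> 'a. cofinal_map h |A| A r" by (rule id) auto
  show "Card_order (cofinality A r)" "\<exists>h :: 'a \<Rightarrow> 'a. cofinal_map h (cofinality A r) A r"
    unfolding cofinality_def by (rule least_card[where P = ?P, OF card_of_Card_order ex])+
  assume \<mu>: "Card_order \<mu>" and g: "cofinal_map g \<mu> A r"
  have "\<exists>h :: 'a \<Rightarrow> 'a. cofinal_map h |g ` Field \<mu>| A r"
    using g by (intro id) (auto simp: cofinal_map_def)
  then have "cofinality A r \<le>o |g ` Field \<mu>|"
    unfolding cofinality_def
    by (intro least_card(3)[where P = ?P, OF card_of_Card_order ex] card_of_Card_order)
  also have "|g ` Field \<mu>| \<le>o |Field \<mu>|" by (rule card_of_image)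
  also have "|Field \<mu>| =o \<mu>" using \<mu> by (rule card_of_Field_ordIso)
  finally show "cofinality A r \<le>o \<mu>" .
qed


section \<open>The class K(M) and its limit\<close>

datatype 'f xfun = BaseF 'f | FSym
datatype 'r xrel = BaseR 'r | VSym | MSym | NSym | TriSym

definition ext_lang :: "('f, 'r) lang \<Rightarrow> ('f xfun, 'r xrel) lang" where
  "ext_lang L0 = \<lparr>
     Fsyms = insert FSym (BaseF ` Fsyms L0),
     Rsyms = {VSym, MSym, NSym, TriSym} \<union> BaseR ` Rsyms L0,
     farity = (\<lambda>g. case g of BaseF g0 \<Rightarrow> farity L0 g0 | FSym \<Rightarrow> 2),
     rarity = (\<lambda>R. case R of BaseR R0 \<Rightarrow> rarity L0 R0 | VSym \<Rightarrow> 1 | MSym \<Rightarrow> 1 | NSym \<Rightarrow> 1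
                           | TriSym \<Rightarrow> 2)\<rparr>"

type_synonym ('a, 'f, 'r) xstruct = "('a, 'f xfun, 'r xrel) struct"

definition Vset :: "('a, 'f, 'r) xstruct \<Rightarrow> 'a set" where
  "Vset A = {x\<in>univ A. rint A VSym [x]}"

definition Mset :: "('a, 'f, 'r) xstruct \<Rightarrow> 'a set" where
  "Mset A = {x\<in>univ A. rint A MSym [x]}"

definition Nset :: "('a, 'f, 'r) xstruct \<Rightarrow> 'a set" where
  "Nset A = {x\<in>univ A. rint A NSym [x]}"

definition order_on :: "('a, 'f, 'r) struct \<Rightarrow> 'r \<Rightarrow> 'a set \<Rightarrow> 'a rel" where
  "order_on S R A = {(x, y). x \<in> A \<and> y \<in> A \<and> rint S R [x, y]}"

abbreviation Vless :: "('a, 'f, 'r) xstruct \<Rightarrow> 'a rel" where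
  "Vless A \<equiv> order_on A TriSym (Vset A)"

abbreviation Mless :: "'r \<Rightarrow> ('a, 'f, 'r) xstruct \<Rightarrow> 'a rel" where
  "Mless lt A \<equiv> order_on A (BaseR lt) (Mset A)"

abbreviation ff :: "('a, 'f, 'r) xstruct \<Rightarrow> 'a \<Rightarrow> 'a \<Rightarrow> 'a" where
  "ff A x y \<equiv> fint A FSym [x, y]"

definition Mpart :: "('a, 'f, 'r) xstruct \<Rightarrow> ('a, 'f, 'r) struct" where
  "Mpart A = \<lparr>univ = Mset A, fint = (\<lambda>g. fint A (BaseF g)), rint = (\<lambda>R. rint A (BaseR R))\<rparr>"

text \<open>The symbols of \<open>L0\<close> are meant to live on \<open>Mset A\<close>, \<open>\<triangleleft>\<close> on \<open>Vset A\<close>, and \<open>f\<close> on pairs of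
  distinct elements of \<open>Vset A\<close>. Elsewhere relations are false and, since structures are total,
  functions return their first argument. Without such a normalization two members of K(M)
  could disagree on tuples from \<open>M\<close> itself and K(M) would have no limit.\<close>

definition trivial_elsewhere :: "('f, 'r) lang \<Rightarrow> ('a, 'f, 'r) xstruct \<Rightarrow> bool" where
  "trivial_elsewhere L0 A \<longleftrightarrow>
     (\<forall>R\<in>Rsyms L0. \<forall>xs\<in>tuples (univ A) (rarity L0 R). rint A (BaseR R) xs \<longrightarrow> set xs \<subseteq> Mset A) \<and>
     (\<forall>g\<in>Fsyms L0. \<forall>xs\<in>tuples (univ A) (farity L0 g).
        \<not> set xs \<subseteq> Mset A \<longrightarrow> fint A (BaseF g) xs = hd xs) \<and>
     (\<forall>x\<in>univ A. \<forall>y\<in>univ A. rint A TriSym [x, y] \<longrightarrow> x \<in> Vset A \<and> y \<in> Vset A) \<and>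
     (\<forall>x\<in>univ A. \<forall>y\<in>univ A. \<not> (x \<in> Vset A \<and> y \<in> Vset A \<and> x \<noteq> y) \<longrightarrow> ff A x y = x)"

text \<open>K(M) is taken closed under isomorphism: the \<open>M\<close>-part of a member is a copy of \<open>M\<close>.\<close>

definition in_K ::
    "('f, 'r) lang \<Rightarrow> 'r \<Rightarrow> ('m, 'f, 'r) struct \<Rightarrow> ('a, 'f, 'r) xstruct \<Rightarrow> bool" where
  "in_K L0 lt M A \<longleftrightarrow>
     is_structure (ext_lang L0) A \<and> countable (univ A) \<and> trivial_elsewhere L0 A \<and>
     Vset A \<union> Mset A = univ A \<and> Vset A \<inter> Mset A = {} \<and> finite (Vset A) \<and>
     isomorphic L0 (Mpart A) M \<and>
     strict_linear_order_on (Vset A) (Vless A) \<and>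
     (\<forall>x\<in>Vset A. \<forall>y\<in>Vset A. x \<noteq> y \<longrightarrow> ff A x y = ff A y x \<and> ff A x y \<in> Mset A) \<and>
     (\<forall>x\<in>Vset A. \<forall>y\<in>Vset A. \<forall>z\<in>Vset A.
        distinct [x, y, z] \<and> (x, y) \<in> Vless A \<and> (y, z) \<in> Vless A \<longrightarrow>
          (ff A x y = ff A x z \<and> ff A x z = ff A y z) \<or>
          (ff A x y = ff A x z \<and> (ff A x z, ff A y z) \<in> Mless lt A) \<or>
          (ff A x z = ff A y z \<and> (ff A y z, ff A x y) \<in> Mless lt A)) \<and>
     Nset A \<subseteq> Vset A"

text \<open>\<open>B\<close> is a substructure of \<open>S\<close> finitely generated over the copy \<open>Mset S\<close> of \<open>M\<close> in \<open>S\<close>.\<close>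

definition fg_over_M ::
    "('f, 'r) lang \<Rightarrow> ('a, 'f, 'r) xstruct \<Rightarrow> ('a, 'f, 'r) xstruct \<Rightarrow> bool" where
  "fg_over_M L0 S B \<longleftrightarrow>
     (\<exists>A0. finite A0 \<and> A0 \<subseteq> univ S \<and> B = S\<lparr>univ := generated (ext_lang L0) S A0 \<union> Mset S\<rparr>)"

text \<open>Members of K(M) are countable, so those with a universe of natural numbers represent all
  of them up to isomorphism.\<close>

definition fraisse_limit ::
    "('f, 'r) lang \<Rightarrow> 'r \<Rightarrow> ('m, 'f, 'r) struct \<Rightarrow> ('a, 'f, 'r) xstruct \<Rightarrow> bool" where
  "fraisse_limit L0 lt M F \<longleftrightarrow>
     is_structure (ext_lang L0) F \<and> countable (univ F) \<and> isomorphic L0 (Mpart F) M \<and>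
     (\<forall>B. fg_over_M L0 F B \<longrightarrow> in_K L0 lt M B) \<and>
     (\<forall>A :: (nat, 'f, 'r) xstruct. in_K L0 lt M A \<longrightarrow>
        (\<exists>B. fg_over_M L0 F B \<and> isomorphic (ext_lang L0) A B)) \<and>
     (\<forall>B C g. fg_over_M L0 F B \<and> fg_over_M L0 F C \<and> isomorphism (ext_lang L0) B C g \<longrightarrow>
        (\<exists>h. isomorphism (ext_lang L0) F F h \<and> (\<forall>x\<in>univ B. h x = g x)))"

end

theory Submission
  imports Defs
begin

text \<open>For a fixed point \<open>v\<close> of \<open>V\<close>, the triple condition makes \<open>w \<mapsto> f(w, v)\<close> weakly monotone as \<open>w\<close>
  approaches \<open>v\<close> from either side. If this map is onto \<open>M\<close> on both sides, then both characters of
  \<open>v\<close> equal the cofinality of \<open>M\<close>, and a value of \<open>f\<close> above \<open>f(x, y)\<close> yields a point between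
  \<open>x\<close> and \<open>y\<close>. Surjectivity holds in the limit \<open>F\<close>: the two-point structure with prescribed value
  \<open>m\<close> lies in K(M), and homogeneity moves it to \<open>v\<close>. By downward Loewenheim--Skolem, every finite
  subset of a model \<open>G\<close> lies in a copy of \<open>F\<close> inside \<open>G\<close>, and the properties used are
  \<open>\<forall>\<exists>\<close>, so they hold in \<open>G\<close>.\<close>

section \<open>Cofinality and character\<close>

text \<open>Characters cannot be transferred from \<open>F\<close> to \<open>G\<close>: in the
  countable \<open>F\<close> they are all countable, while \<open>G\<close> is not assumed
  countable. Hence only the facts collected in \<open>valued_order\<close> are transferred, and the
  characters are computed inside \<open>G\<close> from its own \<open>M\<close>-part. On both sides
  of a point this gives the cofinality of \<open>M\<close>, never its coinitiality, because the
  triple condition is an ultrametric law with minimum: values grow toward the point from either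
  side. Moving a two-point copy to \<open>v\<close> meets two obstacles. Points of \<open>V\<close>
  may differ in the predicate \<open>N\<close>, so the copy has to be built with the
  \<open>N\<close>-status of \<open>v\<close>. Moreover the copy of \<open>M\<close> in the
  two-point structure is embedded in \<open>F\<close> only up to an automorphism of
  \<open>M\<close>, which may differ from the identity. The partial isomorphism handed to
  homogeneity must induce this very automorphism on \<open>M\<close>; otherwise the value of
  \<open>f\<close> brought back to \<open>v\<close> might differ from \<open>m\<close>.\<close>

lemma cofinality_monotone_image:
  assumes "total_on A r" and "strict_linear_order_on B s"
    and no_last: "\<And>b. b \<in> B \<Longrightarrow> \<exists>c\<in>B. (b, c) \<in> s"
    and p: "p ` A = B"
    and mono: "\<And>x y. \<lbrakk>x \<in> A; y \<in> A; (x, y) \<in> r\<rbrakk> \<Longrightarrow> p x = p y \<or> (p x, p y) \<in> s"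
  shows "cofinality A r =o cofinality B s"
proof -
  have tr: "\<And>x y z. (x, y) \<in> s \<Longrightarrow> (y, z) \<in> s \<Longrightarrow> (x, z) \<in> s" and irr: "\<And>x. (x, x) \<notin> s"
    using assms(2) by (auto simp: strict_linear_order_on_def irrefl_def dest: transD)
  obtain h where h: "cofinal_map h (cofinality B s) B s"
    using cofinality(2) by blast
  let ?q = "inv_into A p"
  have q: "?q b \<in> A" "p (?q b) = b" if "b \<in> B" for b
    using that p by (auto simp: inv_into_into f_inv_into_f)
  have "cofinal_map (?q \<circ> h) (cofinality B s) A r"
    unfolding cofinal_map_def
  proof (intro conjI ballI)
    show "(?q \<circ> h) ` Field (cofinality B s) \<subseteq> A"
      using h q by (auto simp: cofinal_map_def)
    fix a assume a: "a \<in> A"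
    \<comment> \<open>A value strictly above \<open>p a\<close> is needed: \<open>p\<close> is only
      weakly monotone, so a chosen preimage of \<open>p a\<close> itself may lie below
      \<open>a\<close>. A preimage of a larger value cannot.\<close>
    then obtain b where "b \<in> B" "(p a, b) \<in> s" using no_last p by blast
    then obtain i where i: "i \<in> Field (cofinality B s)" "(p a, h i) \<in> s"
      using h tr unfolding cofinal_map_def by metis
    have hi: "h i \<in> B" using h i by (auto simp: cofinal_map_def)
    have "a = ?q (h i) \<or> (a, ?q (h i)) \<in> r \<or> (?q (h i), a) \<in> r"
      using assms(1) a q[OF hi] by (auto simp: total_on_def)
    then have "a = ?q (h i) \<or> (a, ?q (h i)) \<in> r"
      using mono[of "?q (h i)" a] q[OF hi] a i tr irr by metis
    then show "\<exists>i\<in>Field (cofinality B s). a = (?q \<circ> h) i \<or> (a, (?q \<circ> h) i) \<in> r"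
      using i by auto
  qed
  then have le: "cofinality A r \<le>o cofinality B s"
    by (rule cofinality(3)[OF cofinality(1)])
  obtain g where g: "cofinal_map g (cofinality A r) A r"
    using cofinality(2) by blast
  have "cofinal_map (p \<circ> g) (cofinality A r) B s"
    unfolding cofinal_map_def
  proof (intro conjI ballI)
    show "(p \<circ> g) ` Field (cofinality A r) \<subseteq> B"
      using g p by (auto simp: cofinal_map_def)
    fix b assume "b \<in> B"
    then obtain a where a: "a \<in> A" "b = p a" using p by blast
    then obtain i where i: "i \<in> Field (cofinality A r)" "a = g i \<or> (a, g i) \<in> r"
      using g unfolding cofinal_map_def by blast
    have "g i \<in> A" using g i by (auto simp: cofinal_map_def)
    then have "b = p (g i) \<or> (b, p (g i)) \<in> s" using mono[of a "g i"] a i by auto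
    then show "\<exists>i\<in>Field (cofinality A r). b = (p \<circ> g) i \<or> (b, (p \<circ> g) i) \<in> s"
      using i by auto
  qed
  then have "cofinality B s \<le>o cofinality A r"
    by (rule cofinality(3)[OF cofinality(1)])
  with le show ?thesis by (simp add: ordIso_iff_ordLeq)
qed

text \<open>\<open>least_card\<close> is specified only once some cardinal satisfies its predicate,
  so each of the two nested minima needs a witness: the left character for a point, and the
  character of any one point for the whole order.\<close>

lemma character_ordIso:
  assumes "A \<noteq> {}" and "\<And>m. m \<in> A \<Longrightarrow> left_character A r m =o \<mu>"
    and "\<And>m. m \<in> A \<Longrightarrow> right_character A r m =o \<mu>"
  shows "character A r =o \<mu>"
proof -
  have point: "Card_order (point_character A r m) \<and> point_character A r m =o \<mu>" if "m \<in> A" for m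
  proof -
    let ?P = "\<lambda>\<kappa>. \<kappa> =o left_character A r m \<or> \<kappa> =o right_character A r m"
    have c: "Card_order (left_character A r m)"
      unfolding left_character_def by (rule cofinality(1))
    then have P: "?P (left_character A r m)"
      using ordIso_reflexive card_order_on_def by blast
    show ?thesis
      using least_card(1,2)[where P = ?P, OF c P] assms(2,3)[OF that]
      unfolding point_character_def[symmetric] by (blast intro: ordIso_transitive)
  qed
  obtain m where m: "m \<in> A" using assms(1) by blast
  let ?P = "\<lambda>\<kappa>. \<exists>m\<in>A. \<kappa> =o point_character A r m"
  have c: "Card_order (point_character A r m)" using point[OF m] by blast
  then have P: "?P (point_character A r m)"
    using m ordIso_reflexive card_order_on_def by blast
  show ?thesis
    using least_card(2)[where P = ?P, OF c P] point
    unfolding character_def[symmetric] by (blast intro: ordIso_transitive)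
qed


section \<open>Orders with a valuation on pairs\<close>

text \<open>Isolates what the order argument uses from languages and structures, so that the same
  facts can be pulled back along an isomorphism and assembled from countable pieces.
  \<open>no_last\<close> allows any value to be exceeded strictly, which serves both the cofinality
  comparison and density.\<close>

locale valued_order =
  fixes V :: "'a set" and r :: "'a rel" and M :: "'b set" and s :: "'b rel"
    and f :: "'a \<Rightarrow> 'a \<Rightarrow> 'b"
  assumes nonempty: "V \<noteq> {}"
    and linear_V: "strict_linear_order_on V r"
    and linear_M: "strict_linear_order_on M s"
    and no_last: "m \<in> M \<Longrightarrow> \<exists>n\<in>M. (m, n) \<in> s"
    and f_commute: "\<lbrakk>x \<in> V; y \<in> V; x \<noteq> y\<rbrakk> \<Longrightarrow> f x y = f y x"
    and f_in: "\<lbrakk>x \<in> V; y \<in> V; x \<noteq> y\<rbrakk> \<Longrightarrow> f x y \<in> M"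
    and f_triple: "\<lbrakk>x \<in> V; y \<in> V; z \<in> V; (x, y) \<in> r; (y, z) \<in> r\<rbrakk> \<Longrightarrow>
      f x y = f x z \<and> f x z = f y z \<or>
      f x y = f x z \<and> (f x z, f y z) \<in> s \<or>
      f x z = f y z \<and> (f y z, f x y) \<in> s"
    and below: "\<lbrakk>v \<in> V; m \<in> M\<rbrakk> \<Longrightarrow> \<exists>w\<in>V. (w, v) \<in> r \<and> f w v = m"
    and above: "\<lbrakk>v \<in> V; m \<in> M\<rbrakk> \<Longrightarrow> \<exists>w\<in>V. (v, w) \<in> r \<and> f v w = m"
begin

lemma irreflexive: "(x, x) \<notin> r" "(m, m) \<notin> s"
  and transitive: "(x, y) \<in> r \<Longrightarrow> (y, z) \<in> r \<Longrightarrow> (x, z) \<in> r"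
    "(m, n) \<in> s \<Longrightarrow> (n, k) \<in> s \<Longrightarrow> (m, k) \<in> s"
  and total: "x \<in> V \<Longrightarrow> y \<in> V \<Longrightarrow> x = y \<or> (x, y) \<in> r \<or> (y, x) \<in> r"
  using linear_V linear_M
  by (auto simp: strict_linear_order_on_def irrefl_def total_on_def dest: transD)

text \<open>In each case of the triple condition the outer pair \<open>x\<close>, \<open>z\<close>
  receives the minimum of the values of the two inner pairs.\<close>

lemma f_mono_below:
  assumes "x \<in> V" "y \<in> V" "v \<in> V" "(x, y) \<in> r" "(y, v) \<in> r"
  shows "f x v = f y v \<or> (f x v, f y v) \<in> s"
  using f_triple[OF assms] by metis

lemma f_mono_above:
  assumes "x \<in> V" "y \<in> V" "v \<in> V" "(v, y) \<in> r" "(y, x) \<in> r"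
  shows "f v x = f v y \<or> (f v x, f v y) \<in> s"
  using f_triple[of v y x] assms by metis

lemma left_character_ordIso:
  assumes v: "v \<in> V"
  shows "left_character V r v =o cofinality M s"
  unfolding left_character_def
proof (rule cofinality_monotone_image[where p = "\<lambda>w. f w v"])
  show "total_on {n \<in> V. (n, v) \<in> r} r"
    using total by (auto simp: total_on_def)
  show "(\<lambda>w. f w v) ` {n \<in> V. (n, v) \<in> r} = M"
    using f_in v irreflexive(1) below[OF v] by (auto simp: image_iff) metis+
qed (use linear_M no_last f_mono_below v in auto)

text \<open>The order on \<open>V\<close> is reversed but the one on \<open>M\<close> is not:
  descending toward \<open>v\<close> increases the value, so coinitiality above \<open>v\<close>
  becomes cofinality of \<open>M\<close>.\<close>

lemma right_character_ordIso:
  assumes v: "v \<in> V"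
  shows "right_character V r v =o cofinality M s"
  unfolding right_character_def
proof (rule cofinality_monotone_image[where p = "f v"])
  show "total_on {n \<in> V. (v, n) \<in> r} (r\<inverse>)"
    using total by (auto simp: total_on_def)
  show "f v ` {n \<in> V. (v, n) \<in> r} = M"
    using f_in v irreflexive(1) above[OF v] by (auto simp: image_iff) metis+
qed (use linear_M no_last f_mono_above v in auto)

lemma character_ordIso_cofinality: "character V r =o cofinality M s"
  using nonempty left_character_ordIso right_character_ordIso by (rule character_ordIso)

lemma dense: "dense_linear_ordering V r"
  unfolding dense_linear_ordering_def
proof (intro conjI ballI impI nonempty linear_V)
  fix x y assume x: "x \<in> V" and y: "y \<in> V" and xy: "(x, y) \<in> r"
  have "x \<noteq> y" using xy irreflexive by auto
  then obtain n where n: "n \<in> M" "(f x y, n) \<in> s" using no_last f_in x y by blast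
  obtain z where z: "z \<in> V" "(z, y) \<in> r" "f z y = n" using below[OF y n(1)] by blast
  \<comment> \<open>If \<open>z\<close> were at or below \<open>x\<close>, monotonicity toward
    \<open>y\<close> would bound \<open>n = f z y\<close> by \<open>f x y\<close>, which is smaller
    than \<open>n\<close>.\<close>
  have "z \<noteq> x" "(z, x) \<notin> r"
    using n(2) z f_mono_below[OF z(1) x y _ xy] irreflexive(2) transitive(2) by metis+
  then show "\<exists>z\<in>V. (x, z) \<in> r \<and> (z, y) \<in> r" using total[OF x z(1)] z by blast
qed

end

section \<open>Transfer of the axioms along injections and directed unions\<close>

lemma valued_order_pullback:
  assumes "valued_order (h ` V) r' (h ` M) s' f'"
    and inj: "inj_on h U" and U: "V \<union> M \<subseteq> U" and r: "r \<subseteq> V \<times> V" and s: "s \<subseteq> M \<times> M"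
    and hr: "\<And>x y. \<lbrakk>x \<in> V; y \<in> V\<rbrakk> \<Longrightarrow> (x, y) \<in> r \<longleftrightarrow> (h x, h y) \<in> r'"
    and hs: "\<And>x y. \<lbrakk>x \<in> M; y \<in> M\<rbrakk> \<Longrightarrow> (x, y) \<in> s \<longleftrightarrow> (h x, h y) \<in> s'"
    and hf: "\<And>x y. \<lbrakk>x \<in> V; y \<in> V; x \<noteq> y\<rbrakk> \<Longrightarrow> f x y \<in> U \<and> h (f x y) = f' (h x) (h y)"
  shows "valued_order V r M s f"
proof -
  interpret T: valued_order "h ` V" r' "h ` M" s' f' by fact
  have inj_iff: "h x = h y \<longleftrightarrow> x = y" if "x \<in> U" "y \<in> U" for x y
    using inj that by (auto simp: inj_on_def)
  have in_M: "f x y \<in> M" if "x \<in> V" "y \<in> V" "x \<noteq> y" for x y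
  proof -
    have "h x \<noteq> h y" using that inj_iff[of x y] U by auto
    \<comment> \<open>\<open>h\<close> is controlled only on \<open>U\<close>. That its value lies
      in the image of \<open>M\<close> puts \<open>f x y\<close> itself into \<open>M\<close> only
      because \<open>f x y\<close> is known to lie in \<open>U\<close>, where \<open>h\<close> is
      injective.\<close>
    then have "h (f x y) \<in> h ` M" using T.f_in[of "h x" "h y"] that hf by auto
    then show ?thesis using hf[OF that] inj_iff U by auto
  qed
  show ?thesis
  proof
    show "V \<noteq> {}" using T.nonempty by auto
    show "strict_linear_order_on V r"
      unfolding strict_linear_order_on_def
    proof (intro conjI)
      show "trans r"
      proof (rule transI)
        fix x y z assume xyz: "(x, y) \<in> r" "(y, z) \<in> r"
        then have "x \<in> V" "y \<in> V" "z \<in> V" using r by auto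
        then show "(x, z) \<in> r" using xyz hr T.transitive(1) by blast
      qed
      show "irrefl r" using r hr T.irreflexive(1) unfolding irrefl_def by blast
      show "total_on V r"
      proof (rule total_onI)
        fix x y assume xy: "x \<in> V" "y \<in> V" "x \<noteq> y"
        then have "h x \<noteq> h y" using inj_iff[of x y] U by auto
        then show "(x, y) \<in> r \<or> (y, x) \<in> r" using T.total[of "h x" "h y"] hr xy by blast
      qed
    qed
    show "strict_linear_order_on M s"
      unfolding strict_linear_order_on_def
    proof (intro conjI)
      show "trans s"
      proof (rule transI)
        fix x y z assume xyz: "(x, y) \<in> s" "(y, z) \<in> s"
        then have "x \<in> M" "y \<in> M" "z \<in> M" using s by auto
        then show "(x, z) \<in> s" using xyz hs T.transitive(2) by blast
      qed
      show "irrefl s" using s hs T.irreflexive(2) unfolding irrefl_def by blast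
      show "total_on M s"
      proof (rule total_onI)
        fix x y assume xy: "x \<in> M" "y \<in> M" "x \<noteq> y"
        then have "h x \<noteq> h y" using inj_iff[of x y] U by auto
        then have "(h x, h y) \<in> s' \<or> (h y, h x) \<in> s'"
          using T.linear_M xy by (simp add: total_on_def strict_linear_order_on_def)
        then show "(x, y) \<in> s \<or> (y, x) \<in> s" using hs xy by blast
      qed
    qed
    show "\<exists>n\<in>M. (m, n) \<in> s" if "m \<in> M" for m
      using T.no_last[of "h m"] that hs by auto
    show "f x y = f y x" if "x \<in> V" "y \<in> V" "x \<noteq> y" for x y
    proof -
      have "h x \<noteq> h y" using that inj_iff[of x y] U by auto
      then have "h (f x y) = h (f y x)"
        using T.f_commute[of "h x" "h y"] that hf[of x y] hf[of y x] by simp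
      then show ?thesis using inj_iff hf[of x y] hf[of y x] that by metis
    qed
    show "f x y \<in> M" if "x \<in> V" "y \<in> V" "x \<noteq> y" for x y
      using in_M that .
    show "f x y = f x z \<and> f x z = f y z \<or> f x y = f x z \<and> (f x z, f y z) \<in> s \<or>
        f x z = f y z \<and> (f y z, f x y) \<in> s"
      if V: "x \<in> V" "y \<in> V" "z \<in> V" and xyz: "(x, y) \<in> r" "(y, z) \<in> r" for x y z
    proof -
      have xyz': "(h x, h y) \<in> r'" "(h y, h z) \<in> r'" using V xyz hr by blast+
      have "x \<noteq> y" "y \<noteq> z" "x \<noteq> z"
        using xyz' T.irreflexive(1) T.transitive(1) by metis+
      note ne = this
      then have m: "f x y \<in> M" "f x z \<in> M" "f y z \<in> M" using in_M V by blast+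
      have "h (f x y) = h (f x z) \<and> h (f x z) = h (f y z) \<or>
          h (f x y) = h (f x z) \<and> (h (f x z), h (f y z)) \<in> s' \<or>
          h (f x z) = h (f y z) \<and> (h (f y z), h (f x y)) \<in> s'"
        using T.f_triple[OF _ _ _ xyz'] V hf ne by simp
      then show ?thesis
        using m hs inj_iff[of "f x y" "f x z"] inj_iff[of "f x z" "f y z"] U by auto
    qed
    show "\<exists>w\<in>V. (w, v) \<in> r \<and> f w v = m" if v: "v \<in> V" and m: "m \<in> M" for v m
    proof -
      obtain w where "w \<in> V" "(h w, h v) \<in> r'" "f' (h w) (h v) = h m"
        using T.below[of "h v" "h m"] v m by auto
      moreover have "w \<noteq> v" using calculation T.irreflexive(1) by auto
      moreover have "f w v = m"
        using calculation hf[of w v] inj_iff[of "f w v" m] v m U by auto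
      ultimately show ?thesis using hr[of w v] v by blast
    qed
    show "\<exists>w\<in>V. (v, w) \<in> r \<and> f v w = m" if v: "v \<in> V" and m: "m \<in> M" for v m
    proof -
      obtain w where "w \<in> V" "(h v, h w) \<in> r'" "f' (h v) (h w) = h m"
        using T.above[of "h v" "h m"] v m by auto
      moreover have "w \<noteq> v" using calculation T.irreflexive(1) by auto
      moreover have "f v w = m"
        using calculation hf[of v w] inj_iff[of "f v w" m] v m U by auto
      ultimately show ?thesis using hr[of v w] v by blast
    qed
  qed
qed

text \<open>The axioms are \<open>\<forall>\<exists>\<close>-sentences, so they pass to directed unions.\<close>

lemma valued_order_local:
  fixes V M :: "'a set"
  assumes r: "r \<subseteq> V \<times> V" and s: "s \<subseteq> M \<times> M"
    and local: "\<And>X. \<lbrakk>finite X; X \<subseteq> V \<union> M\<rbrakk> \<Longrightarrow> \<exists>H. X \<subseteq> H \<and>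
      valued_order (V \<inter> H) (r \<inter> H \<times> H) (M \<inter> H) (s \<inter> H \<times> H) f"
  shows "valued_order V r M s f"
proof
  show "V \<noteq> {}"
    using local[of "{}"] valued_order.nonempty by fastforce
  show "strict_linear_order_on V r"
    unfolding strict_linear_order_on_def
  proof (intro conjI)
    show "trans r"
    proof (rule transI)
      fix x y z assume xyz: "(x, y) \<in> r" "(y, z) \<in> r"
      obtain H where H: "{x, y, z} \<subseteq> H"
        and "valued_order (V \<inter> H) (r \<inter> H \<times> H) (M \<inter> H) (s \<inter> H \<times> H) f"
        using local[of "{x, y, z}"] xyz r by auto
      interpret H: valued_order "V \<inter> H" "r \<inter> H \<times> H" "M \<inter> H" "s \<inter> H \<times> H" f by fact
      show "(x, z) \<in> r" using H.transitive(1)[of x y z] xyz H by auto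
    qed
    show "irrefl r"
    proof (rule irreflI, rule notI)
      fix x assume x: "(x, x) \<in> r"
      obtain H where H: "{x} \<subseteq> H"
        and "valued_order (V \<inter> H) (r \<inter> H \<times> H) (M \<inter> H) (s \<inter> H \<times> H) f"
        using local[of "{x}"] x r by auto
      interpret H: valued_order "V \<inter> H" "r \<inter> H \<times> H" "M \<inter> H" "s \<inter> H \<times> H" f by fact
      show False using H.irreflexive(1)[of x] x H by auto
    qed
    show "total_on V r"
    proof (rule total_onI)
      fix x y assume xy: "x \<in> V" "y \<in> V" "x \<noteq> y"
      obtain H where H: "{x, y} \<subseteq> H"
        and "valued_order (V \<inter> H) (r \<inter> H \<times> H) (M \<inter> H) (s \<inter> H \<times> H) f"
        using local[of "{x, y}"] xy by auto
      interpret H: valued_order "V \<inter> H" "r \<inter> H \<times> H" "M \<inter> H" "s \<inter> H \<times> H" f by fact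
      show "(x, y) \<in> r \<or> (y, x) \<in> r" using H.total[of x y] xy H by auto
    qed
  qed
  show "strict_linear_order_on M s"
    unfolding strict_linear_order_on_def
  proof (intro conjI)
    show "trans s"
    proof (rule transI)
      fix x y z assume xyz: "(x, y) \<in> s" "(y, z) \<in> s"
      obtain H where H: "{x, y, z} \<subseteq> H"
        and "valued_order (V \<inter> H) (r \<inter> H \<times> H) (M \<inter> H) (s \<inter> H \<times> H) f"
        using local[of "{x, y, z}"] xyz s by auto
      interpret H: valued_order "V \<inter> H" "r \<inter> H \<times> H" "M \<inter> H" "s \<inter> H \<times> H" f by fact
      show "(x, z) \<in> s" using H.transitive(2)[of x y z] xyz H by auto
    qed
    show "irrefl s"
    proof (rule irreflI, rule notI)
      fix x assume x: "(x, x) \<in> s"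
      obtain H where H: "{x} \<subseteq> H"
        and "valued_order (V \<inter> H) (r \<inter> H \<times> H) (M \<inter> H) (s \<inter> H \<times> H) f"
        using local[of "{x}"] x s by auto
      interpret H: valued_order "V \<inter> H" "r \<inter> H \<times> H" "M \<inter> H" "s \<inter> H \<times> H" f by fact
      show False using H.irreflexive(2)[of x] x H by auto
    qed
    show "total_on M s"
    proof (rule total_onI)
      fix x y assume xy: "x \<in> M" "y \<in> M" "x \<noteq> y"
      obtain H where H: "{x, y} \<subseteq> H"
        and "valued_order (V \<inter> H) (r \<inter> H \<times> H) (M \<inter> H) (s \<inter> H \<times> H) f"
        using local[of "{x, y}"] xy by auto
      interpret H: valued_order "V \<inter> H" "r \<inter> H \<times> H" "M \<inter> H" "s \<inter> H \<times> H" f by fact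
      show "(x, y) \<in> s \<or> (y, x) \<in> s"
        using H.linear_M xy H by (auto simp: strict_linear_order_on_def total_on_def)
    qed
  qed
next
  fix m assume m: "m \<in> M"
  obtain H where H: "{m} \<subseteq> H"
    and "valued_order (V \<inter> H) (r \<inter> H \<times> H) (M \<inter> H) (s \<inter> H \<times> H) f"
    using local[of "{m}"] m by auto
  interpret H: valued_order "V \<inter> H" "r \<inter> H \<times> H" "M \<inter> H" "s \<inter> H \<times> H" f by fact
  \<comment> \<open>A universal axiom needs only that \<open>H\<close> contains its arguments; for
    an existential one, a witness inside \<open>H\<close> remains a witness in the whole
    order.\<close>
  show "\<exists>n\<in>M. (m, n) \<in> s" using H.no_last[of m] m H by auto
next
  fix x y assume xy: "x \<in> V" "y \<in> V" "x \<noteq> y"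
  obtain H where H: "{x, y} \<subseteq> H"
    and "valued_order (V \<inter> H) (r \<inter> H \<times> H) (M \<inter> H) (s \<inter> H \<times> H) f"
    using local[of "{x, y}"] xy by auto
  interpret H: valued_order "V \<inter> H" "r \<inter> H \<times> H" "M \<inter> H" "s \<inter> H \<times> H" f by fact
  show "f x y = f y x" using H.f_commute[of x y] xy H by auto
  show "f x y \<in> M" using H.f_in[of x y] xy H by auto
next
  fix x y z assume V: "x \<in> V" "y \<in> V" "z \<in> V" and xyz: "(x, y) \<in> r" "(y, z) \<in> r"
  obtain H where H: "{x, y, z} \<subseteq> H"
    and "valued_order (V \<inter> H) (r \<inter> H \<times> H) (M \<inter> H) (s \<inter> H \<times> H) f"
    using local[of "{x, y, z}"] V by auto
  interpret H: valued_order "V \<inter> H" "r \<inter> H \<times> H" "M \<inter> H" "s \<inter> H \<times> H" f by fact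
  show "f x y = f x z \<and> f x z = f y z \<or> f x y = f x z \<and> (f x z, f y z) \<in> s \<or>
      f x z = f y z \<and> (f y z, f x y) \<in> s"
    using H.f_triple[of x y z] V xyz H by auto
next
  fix v m assume vm: "v \<in> V" "m \<in> M"
  obtain H where H: "{v, m} \<subseteq> H"
    and "valued_order (V \<inter> H) (r \<inter> H \<times> H) (M \<inter> H) (s \<inter> H \<times> H) f"
    using local[of "{v, m}"] vm by auto
  interpret H: valued_order "V \<inter> H" "r \<inter> H \<times> H" "M \<inter> H" "s \<inter> H \<times> H" f by fact
  show "\<exists>w\<in>V. (w, v) \<in> r \<and> f w v = m" using H.below[of v m] vm H by auto
  show "\<exists>w\<in>V. (v, w) \<in> r \<and> f v w = m" using H.above[of v m] vm H by auto
qed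


section \<open>Isomorphisms\<close>

lemma map_in_tuples: "xs \<in> tuples A n \<Longrightarrow> h ` A \<subseteq> B \<Longrightarrow> map h xs \<in> tuples B n"
  by (auto simp: tuples_def)

lemma isomorphism_image: "isomorphism L S T h \<Longrightarrow> h ` univ S = univ T"
  by (simp add: isomorphism_def bij_betw_def)

lemma isomorphism_inverse:
  assumes "isomorphism L S T h"
  shows "isomorphism L T S (inv_into (univ S) h)"
proof -
  let ?k = "inv_into (univ S) h"
  have bij: "bij_betw h (univ S) (univ T)" using assms by (simp add: isomorphism_def)
  have k: "?k ` univ T \<subseteq> univ S" using bij by (auto simp: bij_betw_def inv_into_into)
  have hk: "map h (map ?k ys) = ys" if "ys \<in> tuples (univ T) n" for ys n
    using that bij by (auto simp: tuples_def bij_betw_def f_inv_into_f intro!: map_idI)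
  have kh: "?k (h x) = x" if "x \<in> univ S" for x
    using that bij by (simp add: bij_betw_def)
  have "?k (fint T g ys) = fint S g (map ?k ys)"
    if g: "g \<in> Fsyms L" and ys: "ys \<in> tuples (univ T) (farity L g)" for g ys
  proof -
    have m: "map ?k ys \<in> tuples (univ S) (farity L g)" using ys k by (rule map_in_tuples)
    then have "h (fint S g (map ?k ys)) = fint T g ys"
      using assms g hk[OF ys] by (auto simp: isomorphism_def simp del: map_map)
    moreover have "fint S g (map ?k ys) \<in> univ S"
      using m g assms by (auto simp: isomorphism_def is_structure_def)
    ultimately show ?thesis using kh by metis
  qed
  moreover have "rint T R ys \<longleftrightarrow> rint S R (map ?k ys)"
    if R: "R \<in> Rsyms L" and ys: "ys \<in> tuples (univ T) (rarity L R)" for R ys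
  proof -
    have "map ?k ys \<in> tuples (univ S) (rarity L R)" using ys k by (rule map_in_tuples)
    then show ?thesis
      using assms R hk[OF ys] by (auto simp: isomorphism_def simp del: map_map)
  qed
  ultimately show ?thesis
    using assms bij_betw_inv_into[OF bij] by (simp add: isomorphism_def)
qed

lemma isomorphism_comp:
  assumes S: "isomorphism L S T h" and T: "isomorphism L T U k"
  shows "isomorphism L S U (k \<circ> h)"
proof -
  have h: "h ` univ S \<subseteq> univ T" using isomorphism_image[OF S] by simp
  have "bij_betw (k \<circ> h) (univ S) (univ U)"
    using S T bij_betw_trans by (auto simp: isomorphism_def)
  moreover have "(k \<circ> h) (fint S g xs) = fint U g (map (k \<circ> h) xs)"
    if "g \<in> Fsyms L" "xs \<in> tuples (univ S) (farity L g)" for g xs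
    using S T that map_in_tuples[OF that(2) h] by (auto simp: isomorphism_def)
  moreover have "rint S R xs \<longleftrightarrow> rint U R (map (k \<circ> h) xs)"
    if "R \<in> Rsyms L" "xs \<in> tuples (univ S) (rarity L R)" for R xs
    using S T that map_in_tuples[OF that(2) h] by (auto simp: isomorphism_def)
  ultimately show ?thesis using S T by (simp add: isomorphism_def)
qed

text \<open>Scott sentences are tested, and universality of the limit is stated, on structures of
  natural numbers only. This makes the required copies of structures on other types.\<close>

definition transport :: "('a \<Rightarrow> 'b) \<Rightarrow> ('a, 'f, 'r) struct \<Rightarrow> ('b, 'f, 'r) struct" where
  "transport h S = \<lparr>univ = h ` univ S,
     fint = (\<lambda>g ys. h (fint S g (map (inv_into (univ S) h) ys))),
     rint = (\<lambda>R ys. rint S R (map (inv_into (univ S) h) ys))\<rparr>"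

lemma isomorphism_transport:
  assumes "is_structure L S" and "inj_on h (univ S)"
  shows "isomorphism L S (transport h S) h"
proof -
  let ?k = "inv_into (univ S) h"
  have kh: "map (?k \<circ> h) xs = xs" if "xs \<in> tuples (univ S) n" for xs n
    using that assms(2) by (auto simp: tuples_def intro!: map_idI)
  have "h (fint S g (map ?k ys)) \<in> h ` univ S"
    if "g \<in> Fsyms L" "ys \<in> tuples (h ` univ S) (farity L g)" for g ys
  proof -
    have "map ?k ys \<in> tuples (univ S) (farity L g)"
      using that(2) by (rule map_in_tuples) (auto simp: inv_into_into)
    then show ?thesis using assms(1) that(1) by (auto simp: is_structure_def)
  qed
  then have "is_structure L (transport h S)"
    using assms(1) by (auto simp: is_structure_def transport_def)
  then show ?thesis
    using assms kh by (auto simp: isomorphism_def transport_def bij_betw_def)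
qed

section \<open>Invariance of truth under isomorphism\<close>

lemma eval_trm_in_univ:
  assumes "is_structure L S" and "range e \<subseteq> univ S"
  shows "wf_trm L t \<Longrightarrow> eval_trm S e t \<in> univ S"
proof (induction t)
  case (Fn g ts)
  then have "map (eval_trm S e) ts \<in> tuples (univ S) (farity L g)"
    by (auto simp: tuples_def)
  then show ?case using Fn.prems assms(1) by (auto simp: is_structure_def)
qed (use assms(2) in auto)

lemma eval_trm_isomorphism:
  assumes iso: "isomorphism L S T h" and e: "range e \<subseteq> univ S"
  shows "wf_trm L t \<Longrightarrow> h (eval_trm S e t) = eval_trm T (\<lambda>n. h (e n)) t"
proof (induction t)
  case (Fn g ts)
  have S: "is_structure L S" using iso by (simp add: isomorphism_def)
  have "map (eval_trm S e) ts \<in> tuples (univ S) (farity L g)"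
    using Fn.prems eval_trm_in_univ[OF S e] by (auto simp: tuples_def)
  then have "h (eval_trm S e (Fn g ts)) = fint T g (map h (map (eval_trm S e) ts))"
    using Fn.prems iso by (auto simp: isomorphism_def simp del: map_map)
  also have "map h (map (eval_trm S e) ts) = map (eval_trm T (\<lambda>n. h (e n))) ts"
    using Fn by auto
  finally show ?case by simp
qed auto

lemma sat_isomorphism:
  assumes iso: "isomorphism L S T h"
  shows "wf_fm L \<psi> \<Longrightarrow> range e \<subseteq> univ S \<Longrightarrow> sat S e \<psi> \<longleftrightarrow> sat T (\<lambda>n. h (e n)) \<psi>"
proof (induction \<psi> arbitrary: e)
  case (Eq s t)
  have S: "is_structure L S" and inj: "inj_on h (univ S)"
    using iso by (auto simp: isomorphism_def bij_betw_def)
  then show ?case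
    using Eq eval_trm_isomorphism[OF iso Eq(2), symmetric] eval_trm_in_univ[OF S Eq(2)]
    by (simp add: inj_on_eq_iff)
next
  case (Rel R ts)
  have S: "is_structure L S" using iso by (simp add: isomorphism_def)
  have "map (eval_trm S e) ts \<in> tuples (univ S) (rarity L R)"
    using Rel eval_trm_in_univ[OF S Rel(2)] by (auto simp: tuples_def)
  then have "sat S e (Rel R ts) \<longleftrightarrow> rint T R (map h (map (eval_trm S e) ts))"
    using Rel.prems iso by (auto simp: isomorphism_def simp del: map_map)
  also have "map h (map (eval_trm S e) ts) = map (eval_trm T (\<lambda>n. h (e n))) ts"
    using Rel eval_trm_isomorphism[OF iso Rel(2)] by auto
  finally show ?case by simp
next
  case (Ex n \<psi>)
  have upd: "sat S (e(n := a)) \<psi> \<longleftrightarrow> sat T ((\<lambda>n. h (e n))(n := h a)) \<psi>" if "a \<in> univ S" for a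
  proof -
    have "range (e(n := a)) \<subseteq> univ S" using Ex.prems that by auto
    then show ?thesis using Ex.IH[of "e(n := a)"] Ex.prems by (simp add: if_distrib fun_upd_def)
  qed
  have "sat T (\<lambda>n. h (e n)) (Ex n \<psi>) \<longleftrightarrow> (\<exists>a\<in>univ S. sat T ((\<lambda>n. h (e n))(n := h a)) \<psi>)"
    unfolding sat.simps isomorphism_image[OF iso, symmetric] by blast
  then show ?case using upd by auto
qed auto

lemma is_model_isomorphism:
  assumes iso: "isomorphism L S T h" and "sentence L \<psi>" and "is_model L S \<psi>"
  shows "is_model L T \<psi>"
  unfolding is_model_def
proof (intro conjI allI impI)
  show "is_structure L T" using iso by (simp add: isomorphism_def)
  fix e :: "nat \<Rightarrow> _" assume e: "range e \<subseteq> univ T"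
  let ?e = "\<lambda>n. inv_into (univ S) h (e n)"
  have im: "h ` univ S = univ T" using isomorphism_image[OF iso] .
  then have "range ?e \<subseteq> univ S" using e by (auto intro!: inv_into_into)
  moreover have "(\<lambda>n. h (?e n)) = e" using e im by (auto simp: fun_eq_iff intro!: f_inv_into_f)
  ultimately show "sat T e \<psi>"
    using sat_isomorphism[OF iso, of \<psi> ?e] assms(2,3) by (simp add: sentence_def is_model_def)
qed


section \<open>The downward Loewenheim--Skolem theorem\<close>

text \<open>Skolem functions are taken for these formulas only: the logic has uncountably many
  formulas, but a single formula has countably many subformulas.\<close>

primrec subformulas :: "('f, 'r) fm \<Rightarrow> ('f, 'r) fm set" where
  "subformulas (Eq s t) = {Eq s t}"
| "subformulas (Rel R ts) = {Rel R ts}"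
| "subformulas (Neg \<psi>) = insert (Neg \<psi>) (subformulas \<psi>)"
| "subformulas (Conj \<Psi>) = insert (Conj \<Psi>) (\<Union>n. subformulas (\<Psi> n))"
| "subformulas (Ex n \<psi>) = insert (Ex n \<psi>) (subformulas \<psi>)"

lemma subformulas_refl: "\<psi> \<in> subformulas \<psi>"
  by (cases \<psi>) auto

lemma subformulas_trans: "\<psi> \<in> subformulas \<theta> \<Longrightarrow> subformulas \<psi> \<subseteq> subformulas \<theta>"
  by (induction \<theta>) auto

lemma countable_subformulas: "countable (subformulas \<theta>)"
  by (induction \<theta>) auto

text \<open>Each quantifier passed on the way down frees at most one variable. Finiteness matters
  because the Skolem functions below take finite lists as arguments.\<close>

lemma finite_fv_subformula:
  "\<psi> \<in> subformulas \<theta> \<Longrightarrow> finite (fv \<theta>) \<Longrightarrow> finite (fv \<psi>)"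
proof (induction \<theta>)
  case (Conj \<Psi>)
  have "finite (fv (\<Psi> n))" for n
    using Conj.prems(2) by (rule rev_finite_subset) auto
  then show ?case using Conj by auto
qed auto

lemma eval_trm_cong: "(\<And>n. n \<in> fv_trm t \<Longrightarrow> e n = e' n) \<Longrightarrow> eval_trm S e t = eval_trm S e' t"
proof (induction t)
  case (Fn g ts)
  have "map (eval_trm S e) ts = map (eval_trm S e') ts"
    using Fn.prems by (intro map_cong refl Fn.IH) auto
  then show ?case unfolding eval_trm.simps by (rule arg_cong)
qed auto

lemma sat_cong: "(\<And>n. n \<in> fv \<psi> \<Longrightarrow> e n = e' n) \<Longrightarrow> sat S e \<psi> \<longleftrightarrow> sat S e' \<psi>"
proof (induction \<psi> arbitrary: e e')
  case (Eq s t)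
  have "eval_trm S e s = eval_trm S e' s" "eval_trm S e t = eval_trm S e' t"
    using Eq by (auto intro!: eval_trm_cong)
  then show ?case by simp
next
  case (Rel R ts)
  have "map (eval_trm S e) ts = map (eval_trm S e') ts"
    using Rel by (auto intro!: eval_trm_cong)
  then show ?case by (simp only: sat.simps)
next
  case (Neg \<psi>)
  have "sat S e \<psi> \<longleftrightarrow> sat S e' \<psi>"
    using Neg.prems by (intro Neg.IH) auto
  then show ?case by simp
next
  case (Conj \<Psi>)
  have "sat S e (\<Psi> n) \<longleftrightarrow> sat S e' (\<Psi> n)" for n
    using Conj.prems by (intro Conj.IH) auto
  then show ?case by simp
next
  case (Ex n \<psi>)
  have "sat S (e(n := a)) \<psi> \<longleftrightarrow> sat S (e'(n := a)) \<psi>" for a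
    using Ex.prems by (intro Ex.IH) auto
  then show ?case by simp
qed

text \<open>The universe enters the semantics through quantifiers alone, so restricting it leaves
  \<open>Ex\<close> as the only case with content.\<close>

lemma eval_trm_univ_update: "eval_trm (S\<lparr>univ := H\<rparr>) e t = eval_trm S e t"
proof (induction t)
  case (Fn g ts)
  then have "map (eval_trm (S\<lparr>univ := H\<rparr>) e) ts = map (eval_trm S e) ts" by simp
  moreover have "fint (S\<lparr>univ := H\<rparr>) = fint S" by simp
  ultimately show ?case by (simp only: eval_trm.simps)
qed simp

text \<open>The operations take lists of every length, so one countable index set covers function
  symbols and Skolem functions of all arities; countability survives because there are only
  countably many lists over a countable set.\<close>

lemma countable_closure:
  fixes op :: "'i \<Rightarrow> 'a list \<Rightarrow> 'a"
  assumes "countable I" and "countable X" and "X \<subseteq> U"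
    and U: "\<And>i xs. i \<in> I \<Longrightarrow> xs \<in> lists U \<Longrightarrow> op i xs \<in> U"
  shows "\<exists>H. X \<subseteq> H \<and> H \<subseteq> U \<and> countable H \<and> (\<forall>i\<in>I. \<forall>xs\<in>lists H. op i xs \<in> H)"
proof -
  define step where "step A = A \<union> (\<lambda>(i, xs). op i xs) ` (I \<times> lists A)" for A
  define h where "h n = (step ^^ n) X" for n
  have h_Suc: "h (Suc n) = step (h n)" for n by (simp add: h_def)
  have "countable (h n)" for n
    by (induction n) (use assms(1,2) in \<open>auto simp: h_Suc step_def h_def\<close>)
  moreover have "h n \<subseteq> U" for n
    by (induction n) (use assms(3) U in \<open>force simp: h_Suc step_def h_def\<close>)+
  moreover have mono: "mono h"
    by (rule mono_iff_le_Suc[THEN iffD2]) (auto simp: h_Suc step_def)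
  have "op i xs \<in> (\<Union>n. h n)" if i: "i \<in> I" and xs: "xs \<in> lists (\<Union>n. h n)" for i xs
  proof -
    \<comment> \<open>A list is finite and the stages increase, so all its entries are present at
      one stage.\<close>
    have "\<exists>n. xs \<in> lists (h n)"
      using xs
    proof (induction xs)
      case (Cons x xs)
      then obtain m n where "xs \<in> lists (h m)" "x \<in> h n" by auto
      then have "x # xs \<in> lists (h (max m n))"
        using monoD[OF mono, of m "max m n"] monoD[OF mono, of n "max m n"] by auto
      then show ?case by blast
    qed auto
    then obtain n where "xs \<in> lists (h n)" ..
    then have "op i xs \<in> h (Suc n)" using i by (force simp: h_Suc step_def)
    then show ?thesis by blast
  qed
  moreover have "X \<subseteq> (\<Union>n. h n)" using UN_upper[of 0 UNIV h] by (simp add: h_def)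
  ultimately show ?thesis by (intro exI[of _ "\<Union>n. h n"]) auto
qed

text \<open>The Tarski-Vaught argument, restricted to the subformulas of one sentence: closure under
  chosen witnesses makes every existential subformula true in \<open>S\<close> true in the
  restriction.\<close>

lemma downward_loewenheim_skolem:
  fixes S :: "('a, 'f, 'r) struct"
  assumes model: "is_model L S \<phi>" and "sentence L \<phi>" and "countable (Fsyms L)"
    and "countable X" and "X \<subseteq> univ S"
  obtains H where "X \<subseteq> H" "H \<subseteq> univ S" "countable H" "is_model L (S\<lparr>univ := H\<rparr>) \<phi>"
proof -
  have S: "is_structure L S" using model by (simp add: is_model_def)
  then obtain a0 where a0: "a0 \<in> univ S" by (auto simp: is_structure_def)
  \<comment> \<open>A finite list codes an assignment; variables beyond its length get the default
    \<open>a0\<close>.\<close>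
  define env where "env xs n = (if n < length xs then xs ! n else a0)" for xs :: "'a list" and n
  define witness where "witness \<psi> xs = (case \<psi> of
      Ex n \<theta> \<Rightarrow> if \<exists>a\<in>univ S. sat S ((env xs)(n := a)) \<theta>
        then SOME a. a \<in> univ S \<and> sat S ((env xs)(n := a)) \<theta> else a0
    | _ \<Rightarrow> a0)" for \<psi> :: "('f, 'r) fm" and xs
  have witness_in: "witness \<psi> xs \<in> univ S" for \<psi> xs
  proof (cases "\<exists>n \<theta>. \<psi> = Ex n \<theta> \<and> (\<exists>a\<in>univ S. sat S ((env xs)(n := a)) \<theta>)")
    case True
    then obtain n \<theta> where \<psi>: "\<psi> = Ex n \<theta>" and "\<exists>a. a \<in> univ S \<and> sat S ((env xs)(n := a)) \<theta>"
      by blast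
    from someI_ex[OF this(2)] this(2) show ?thesis by (auto simp: \<psi> witness_def)
  next
    case False
    then show ?thesis using a0 by (auto simp: witness_def split: fm.split)
  qed
  have witness_sat: "sat S ((env xs)(n := witness (Ex n \<theta>) xs)) \<theta>"
    if "sat S (env xs) (Ex n \<theta>)" for n \<theta> xs
  proof -
    have ex: "\<exists>a. a \<in> univ S \<and> sat S ((env xs)(n := a)) \<theta>" using that by auto
    from someI_ex[OF ex] ex show ?thesis by (auto simp: witness_def)
  qed
  \<comment> \<open>Closure under the left summand makes \<open>H\<close> a substructure, closure
    under the right one supplies witnesses. Lists of the wrong length are sent to
    \<open>a0\<close>.\<close>
  define op where "op i xs = (case i of
      Inl g \<Rightarrow> if length xs = farity L g then fint S g xs else a0
    | Inr \<psi> \<Rightarrow> witness \<psi> xs)" for i :: "'f + ('f, 'r) fm" and xs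
  have "countable (Fsyms L <+> subformulas \<phi>)"
    unfolding Plus_def
    by (intro countable_Un countable_image assms(3) countable_subformulas)
  \<comment> \<open>Adding \<open>a0\<close> keeps \<open>H\<close> nonempty even when
    \<open>X\<close> is empty.\<close>
  moreover have "countable (insert a0 X)" "insert a0 X \<subseteq> univ S" using assms(4,5) a0 by auto
  moreover have "op i xs \<in> univ S"
    if "i \<in> Fsyms L <+> subformulas \<phi>" "xs \<in> lists (univ S)" for i xs
    using that S a0 witness_in
    by (auto simp: op_def is_structure_def tuples_def subset_iff split: sum.split)
  ultimately have "\<exists>H. insert a0 X \<subseteq> H \<and> H \<subseteq> univ S \<and> countable H \<and>
      (\<forall>i\<in>Fsyms L <+> subformulas \<phi>. \<forall>xs\<in>lists H. op i xs \<in> H)"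
    by (rule countable_closure)
  then obtain H where H: "insert a0 X \<subseteq> H" "H \<subseteq> univ S" "countable H"
    and op: "\<And>i xs. i \<in> Fsyms L <+> subformulas \<phi> \<Longrightarrow> xs \<in> lists H \<Longrightarrow> op i xs \<in> H"
    by blast
  let ?H = "S\<lparr>univ := H\<rparr>"
  have H_struct: "is_structure L ?H"
    unfolding is_structure_def
  proof (intro conjI ballI)
    show "univ ?H \<noteq> {}" using H(1) by auto
    fix g xs assume "g \<in> Fsyms L" and "xs \<in> tuples (univ ?H) (farity L g)"
    then show "fint ?H g xs \<in> univ ?H"
      using op[of "Inl g" xs] by (auto simp: op_def tuples_def)
  qed
  have eval: "eval_trm ?H e = eval_trm S e" for e
    by (rule ext) (rule eval_trm_univ_update)
  have sat: "\<psi> \<in> subformulas \<phi> \<Longrightarrow> range e \<subseteq> H \<Longrightarrow> sat ?H e \<psi> \<longleftrightarrow> sat S e \<psi>" for \<psi> e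
  proof (induction \<psi> arbitrary: e)
    case (Neg \<psi>)
    then show ?case
      using subformulas_trans[OF Neg.prems(1)] subformulas_refl[of \<psi>] by auto
  next
    case (Conj \<Psi>)
    have "\<Psi> n \<in> subformulas \<phi>" for n
      using subformulas_trans[OF Conj.prems(1)] subformulas_refl[of "\<Psi> n"] by auto
    then show ?case using Conj by auto
  next
    case (Ex n \<psi>)
    have \<psi>: "\<psi> \<in> subformulas \<phi>"
      using subformulas_trans[OF Ex.prems(1)] subformulas_refl[of \<psi>] by auto
    have IH: "sat ?H (e(n := a)) \<psi> \<longleftrightarrow> sat S (e(n := a)) \<psi>" if "a \<in> H" for a
      using Ex.prems(2) that by (intro Ex.IH \<psi>) auto
    show ?case
    proof
      assume "sat ?H e (Ex n \<psi>)"
      then show "sat S e (Ex n \<psi>)" using IH H(2) by auto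
    next
      assume ex: "sat S e (Ex n \<psi>)"
      have "finite (fv (Ex n \<psi>))"
        using finite_fv_subformula[OF Ex.prems(1)] assms(2) by (simp add: sentence_def)
      then obtain k where k: "\<forall>i\<in>fv (Ex n \<psi>). i < k"
        by (auto simp: finite_nat_set_iff_bounded)
      \<comment> \<open>\<open>k\<close> bounds the free variables, so this finite piece of
        \<open>e\<close> has the same effect on the formula, and it is a list over \<open>H\<close>
        to which the Skolem function applies.\<close>
      let ?xs = "map e [0..<k]"
      have env: "i \<in> fv (Ex n \<psi>) \<Longrightarrow> env ?xs i = e i" for i
        using k by (auto simp: env_def)
      have xs: "?xs \<in> lists H" using Ex.prems(2) by (auto simp: image_subset_iff)
      let ?a = "witness (Ex n \<psi>) ?xs"
      have "sat S (env ?xs) (Ex n \<psi>) \<longleftrightarrow> sat S e (Ex n \<psi>)" by (rule sat_cong) (rule env)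
      with ex have "sat S (env ?xs) (Ex n \<psi>)" by simp
      then have "sat S ((env ?xs)(n := ?a)) \<psi>" by (rule witness_sat)
      moreover have "sat S ((env ?xs)(n := ?a)) \<psi> \<longleftrightarrow> sat S (e(n := ?a)) \<psi>"
        by (rule sat_cong) (use env in auto)
      moreover have "?a \<in> H"
        using op[of "Inr (Ex n \<psi>)" ?xs] Ex.prems(1) xs by (auto simp: op_def)
      ultimately show "sat ?H e (Ex n \<psi>)" using IH by auto
    qed
  qed (simp_all add: eval)
  have "sat ?H e \<phi>" if "range e \<subseteq> H" for e
    using sat[OF subformulas_refl that] that H(2) model by (auto simp: is_model_def)
  with H_struct have "is_model L ?H \<phi>" by (simp add: is_model_def)
  then show thesis using that[of H] H by blast
qed


section \<open>The expanded language\<close>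

lemma tuples_1: "tuples A (Suc 0) = (\<lambda>x. [x]) ` A"
  by (auto simp: tuples_def length_Suc_conv)

lemma tuples_2: "tuples A 2 = (\<lambda>(x, y). [x, y]) ` (A \<times> A)"
  by (auto simp: tuples_def length_Suc_conv numeral_2_eq_2)

lemma is_structure_ext_lang:
  "is_structure (ext_lang L0) S \<longleftrightarrow> univ S \<noteq> {} \<and>
    (\<forall>g\<in>Fsyms L0. \<forall>xs\<in>tuples (univ S) (farity L0 g). fint S (BaseF g) xs \<in> univ S) \<and>
    (\<forall>x\<in>univ S. \<forall>y\<in>univ S. ff S x y \<in> univ S)"
  by (auto simp: is_structure_def ext_lang_def tuples_2)

lemma isomorphism_ext_lang:
  "isomorphism (ext_lang L0) S T h \<longleftrightarrow>
    is_structure (ext_lang L0) S \<and> is_structure (ext_lang L0) T \<and> bij_betw h (univ S) (univ T) \<and>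
    (\<forall>g\<in>Fsyms L0. \<forall>xs\<in>tuples (univ S) (farity L0 g).
       h (fint S (BaseF g) xs) = fint T (BaseF g) (map h xs)) \<and>
    (\<forall>x\<in>univ S. \<forall>y\<in>univ S. h (ff S x y) = ff T (h x) (h y)) \<and>
    (\<forall>R\<in>Rsyms L0. \<forall>xs\<in>tuples (univ S) (rarity L0 R).
       rint S (BaseR R) xs \<longleftrightarrow> rint T (BaseR R) (map h xs)) \<and>
    (\<forall>x\<in>univ S. (rint S VSym [x] \<longleftrightarrow> rint T VSym [h x]) \<and>
       (rint S MSym [x] \<longleftrightarrow> rint T MSym [h x]) \<and> (rint S NSym [x] \<longleftrightarrow> rint T NSym [h x])) \<and>
    (\<forall>x\<in>univ S. \<forall>y\<in>univ S. rint S TriSym [x, y] \<longleftrightarrow> rint T TriSym [h x, h y])"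
  unfolding isomorphism_def by (auto simp: ext_lang_def tuples_1 tuples_2)

lemma isomorphism_ext_langD:
  assumes "isomorphism (ext_lang L0) S T h"
  shows "\<lbrakk>g \<in> Fsyms L0; xs \<in> tuples (univ S) (farity L0 g)\<rbrakk> \<Longrightarrow>
      h (fint S (BaseF g) xs) = fint T (BaseF g) (map h xs)"
    "\<lbrakk>x \<in> univ S; y \<in> univ S\<rbrakk> \<Longrightarrow> h (ff S x y) = ff T (h x) (h y)"
    "\<lbrakk>R \<in> Rsyms L0; xs \<in> tuples (univ S) (rarity L0 R)\<rbrakk> \<Longrightarrow>
      rint S (BaseR R) xs \<longleftrightarrow> rint T (BaseR R) (map h xs)"
    "x \<in> univ S \<Longrightarrow> rint S VSym [x] \<longleftrightarrow> rint T VSym [h x]"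
    "x \<in> univ S \<Longrightarrow> rint S MSym [x] \<longleftrightarrow> rint T MSym [h x]"
    "x \<in> univ S \<Longrightarrow> rint S NSym [x] \<longleftrightarrow> rint T NSym [h x]"
    "\<lbrakk>x \<in> univ S; y \<in> univ S\<rbrakk> \<Longrightarrow> rint S TriSym [x, y] \<longleftrightarrow> rint T TriSym [h x, h y]"
    "\<lbrakk>x \<in> univ S; y \<in> univ S\<rbrakk> \<Longrightarrow> ff S x y \<in> univ S"
  using assms unfolding isomorphism_ext_lang is_structure_ext_lang by simp_all

lemma isomorphism_Vset:
  assumes "isomorphism (ext_lang L0) S T h"
  shows "h ` Vset S = Vset T"
  using isomorphism_ext_langD(4)[OF assms]
  unfolding Vset_def isomorphism_image[OF assms, symmetric] by blast

lemma isomorphism_Mset: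
  assumes "isomorphism (ext_lang L0) S T h"
  shows "h ` Mset S = Mset T"
  using isomorphism_ext_langD(5)[OF assms]
  unfolding Mset_def isomorphism_image[OF assms, symmetric] by blast

lemma valued_order_isomorphism:
  assumes iso: "isomorphism (ext_lang L0) S T h" and lt: "lt \<in> Rsyms L0" "rarity L0 lt = 2"
    and "valued_order (Vset T) (Vless T) (Mset T) (Mless lt T) (ff T)"
  shows "valued_order (Vset S) (Vless S) (Mset S) (Mless lt S) (ff S)"
proof (rule valued_order_pullback[where h = h and U = "univ S"])
  show "valued_order (h ` Vset S) (Vless T) (h ` Mset S) (Mless lt T) (ff T)"
    using assms(4) by (simp add: isomorphism_Vset[OF iso] isomorphism_Mset[OF iso])
  show "inj_on h (univ S)" using iso by (simp add: isomorphism_def bij_betw_def)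
  show V: "Vset S \<union> Mset S \<subseteq> univ S" by (auto simp: Vset_def Mset_def)
  show "(x, y) \<in> Vless S \<longleftrightarrow> (h x, h y) \<in> Vless T" if "x \<in> Vset S" "y \<in> Vset S" for x y
  proof -
    have "rint S TriSym [x, y] \<longleftrightarrow> rint T TriSym [h x, h y]"
      using that V isomorphism_ext_langD(7)[OF iso] by blast
    then show ?thesis using that isomorphism_Vset[OF iso] by (auto simp: order_on_def)
  qed
  show "(x, y) \<in> Mless lt S \<longleftrightarrow> (h x, h y) \<in> Mless lt T" if "x \<in> Mset S" "y \<in> Mset S" for x y
  proof -
    have "[x, y] \<in> tuples (univ S) (rarity L0 lt)" using that V lt(2) by (auto simp: tuples_2)
    then have "rint S (BaseR lt) [x, y] \<longleftrightarrow> rint T (BaseR lt) (map h [x, y])"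
      using isomorphism_ext_langD(3)[OF iso lt(1)] by blast
    then show ?thesis
      using that isomorphism_Mset[OF iso] by (auto simp: order_on_def)
  qed
  show "ff S x y \<in> univ S \<and> h (ff S x y) = ff T (h x) (h y)"
    if "x \<in> Vset S" "y \<in> Vset S" for x y
    using that V isomorphism_ext_langD(2,8)[OF iso] by blast
qed (auto simp: order_on_def)

lemma restrict_univ:
  fixes S :: "('a, 'f, 'r) xstruct"
  assumes "H \<subseteq> univ S"
  shows "Vset (S\<lparr>univ := H\<rparr>) = Vset S \<inter> H" "Mset (S\<lparr>univ := H\<rparr>) = Mset S \<inter> H"
    "Nset (S\<lparr>univ := H\<rparr>) = Nset S \<inter> H"
    "Vless (S\<lparr>univ := H\<rparr>) = Vless S \<inter> H \<times> H"
    "Mless lt (S\<lparr>univ := H\<rparr>) = Mless lt S \<inter> H \<times> H"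
  using assms by (auto simp: Vset_def Mset_def Nset_def order_on_def)


section \<open>The limit\<close>

text \<open>The numbers 0 and 1 are the two points, in this order, so \<open>T\<close> will have to
  avoid them. Testing \<open>set xs\<close> makes \<open>f\<close> symmetric, and all other values
  follow the normalization of \<open>trivial_elsewhere\<close>. \<open>N\<close> is a parameter
  because a point will have to match a given point of the limit.\<close>

definition two_point ::
    "(nat, 'f, 'r) struct \<Rightarrow> nat \<Rightarrow> nat set \<Rightarrow> (nat, 'f, 'r) xstruct" where
  "two_point T m N = \<lparr>univ = {0, 1} \<union> univ T,
     fint = (\<lambda>g xs. case g of
         BaseF g0 \<Rightarrow> if set xs \<subseteq> univ T then fint T g0 xs else hd xs
       | FSym \<Rightarrow> if set xs = {0, 1} then m else hd xs),
     rint = (\<lambda>R xs. case R of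
         BaseR R0 \<Rightarrow> set xs \<subseteq> univ T \<and> rint T R0 xs
       | VSym \<Rightarrow> hd xs \<in> {0, 1}
       | MSym \<Rightarrow> hd xs \<in> univ T
       | NSym \<Rightarrow> hd xs \<in> N
       | TriSym \<Rightarrow> xs = [0, 1])\<rparr>"

lemma in_K_two_point:
  assumes iso: "isomorphic L0 T M" and T: "univ T \<subseteq> {2..}" and "countable (univ T)"
    and m: "m \<in> univ T" and N: "N \<subseteq> {0, 1}"
  shows "in_K L0 lt M (two_point T m N)"
proof -
  let ?A = "two_point T m N"
  have T_struct: "is_structure L0 T" using iso by (auto simp: isomorphic_def isomorphism_def)
  have T01: "0 \<notin> univ T" "Suc 0 \<notin> univ T" using T by auto
  have V: "Vset ?A = {0, 1}" and Mset: "Mset ?A = univ T" and Nset: "Nset ?A \<subseteq> {0, 1}"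
    using T01 N by (auto simp: Vset_def Mset_def Nset_def two_point_def)
  have hd_in: "hd xs \<in> A" if "set xs \<subseteq> A" "\<not> set xs \<subseteq> B" for xs and A B :: "nat set"
    using that by (cases xs) auto
  have str: "is_structure (ext_lang L0) ?A"
    unfolding is_structure_ext_lang
  proof (intro conjI ballI)
    show "univ ?A \<noteq> {}" by (simp add: two_point_def)
    show "ff ?A x y \<in> univ ?A" if "x \<in> univ ?A" "y \<in> univ ?A" for x y
      using that m by (auto simp: two_point_def)
    fix g xs assume g: "g \<in> Fsyms L0" and xs: "xs \<in> tuples (univ ?A) (farity L0 g)"
    show "fint ?A (BaseF g) xs \<in> univ ?A"
    proof (cases "set xs \<subseteq> univ T")
      case True
      then have "xs \<in> tuples (univ T) (farity L0 g)" using xs by (simp add: tuples_def)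
      then show ?thesis using T_struct g True by (simp add: is_structure_def two_point_def)
    next
      case False
      then show ?thesis
        using hd_in[of xs "univ ?A" "univ T"] xs by (simp add: tuples_def two_point_def)
    qed
  qed
  have "isomorphism L0 (Mpart ?A) T id"
    using T_struct
    by (auto simp: isomorphism_def Mpart_def Mset is_structure_def)
      (auto simp: two_point_def tuples_def)
  then have isoM: "isomorphic L0 (Mpart ?A) M"
    using iso isomorphism_comp unfolding isomorphic_def by blast
  have triv: "trivial_elsewhere L0 ?A"
    unfolding trivial_elsewhere_def V Mset
    using T01 by (auto simp: two_point_def insert_commute doubleton_eq_iff)
  have Vless: "order_on ?A TriSym {0, 1} = {(0, 1)}"
    unfolding order_on_def by (auto simp: two_point_def)
  have "strict_linear_order_on (Vset ?A) (Vless ?A)"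
    unfolding V Vless
    by (auto simp: strict_linear_order_on_def irrefl_def total_on_def intro!: transI)
  moreover have "Vset ?A \<union> Mset ?A = univ ?A" "Vset ?A \<inter> Mset ?A = {}"
    unfolding V Mset using T01 by (auto simp: two_point_def)
  moreover have "ff ?A x y = ff ?A y x \<and> ff ?A x y \<in> Mset ?A"
    if "x \<in> {0, 1}" "y \<in> {0, 1}" "x \<noteq> y" for x y
    using that m unfolding Mset by (auto simp: two_point_def insert_commute)
  moreover have "countable (univ ?A)" using assms(3) by (simp add: two_point_def)
  \<comment> \<open>The triple condition holds vacuously, there being only two points.\<close>
  ultimately show ?thesis
    using str isoM triv Nset unfolding in_K_def V Vless by simp
qed

section \<open>Substructures finitely generated over M\<close>

lemma generated_subset_univ:
  "is_structure L S \<Longrightarrow> A \<subseteq> univ S \<Longrightarrow> generated L S A \<subseteq> univ S"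
proof
  fix x assume S: "is_structure L S" "A \<subseteq> univ S" and "x \<in> generated L S A"
  from this(3) show "x \<in> univ S"
  proof induction
    case (app g xs)
    then have "xs \<in> tuples (univ S) (farity L g)" by (auto simp: tuples_def)
    then show ?case using app S by (auto simp: is_structure_def)
  qed (use S in auto)
qed

text \<open>The conditions defining K(M) are imposed on substructures of \<open>F\<close>, not on
  \<open>F\<close>. A universal one is checked for \<open>F\<close> in a member of the class that
  contains the finitely many points involved.\<close>

lemma fraisse_limit_fg:
  assumes lim: "fraisse_limit L0 lt M F" and "finite X" and "X \<subseteq> univ F"
  obtains H where "H = generated (ext_lang L0) F X \<union> Mset F" "X \<subseteq> H" "H \<subseteq> univ F"
    "fg_over_M L0 F (F\<lparr>univ := H\<rparr>)" "in_K L0 lt M (F\<lparr>univ := H\<rparr>)"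
proof (rule that[OF refl])
  let ?H = "generated (ext_lang L0) F X \<union> Mset F"
  show "X \<subseteq> ?H" by (auto intro: generated.base)
  show "?H \<subseteq> univ F"
    using generated_subset_univ[of "ext_lang L0" F X] assms by (auto simp: fraisse_limit_def Mset_def)
  show fg: "fg_over_M L0 F (F\<lparr>univ := ?H\<rparr>)"
    using assms(2,3) unfolding fg_over_M_def by blast
  then show "in_K L0 lt M (F\<lparr>univ := ?H\<rparr>)" using lim unfolding fraisse_limit_def by blast
qed

text \<open>A single point generates nothing outside \<open>M\<close>: \<open>f\<close> yields
  something new only on two distinct points of \<open>V\<close>, and a function of \<open>L0\<close>
  stays in \<open>M\<close> or returns its first argument. The normalization is available only for
  members of K(M), so it is read off from the generated substructure \<open>H\<close> before
  \<open>H\<close> is identified.\<close>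

lemma fraisse_limit_fg_point:
  assumes lim: "fraisse_limit L0 lt M F" and v: "v \<in> Vset F"
  shows "fg_over_M L0 F (F\<lparr>univ := insert v (Mset F)\<rparr>)"
    "in_K L0 lt M (F\<lparr>univ := insert v (Mset F)\<rparr>)"
proof -
  have "v \<in> univ F" using v by (simp add: Vset_def)
  then obtain H where H: "H = generated (ext_lang L0) F {v} \<union> Mset F" "{v} \<subseteq> H" "H \<subseteq> univ F"
    "fg_over_M L0 F (F\<lparr>univ := H\<rparr>)" "in_K L0 lt M (F\<lparr>univ := H\<rparr>)"
    using fraisse_limit_fg[OF lim, of "{v}"] by auto
  have MH: "Mset F \<subseteq> H" using H(1) by auto
  have triv: "trivial_elsewhere L0 (F\<lparr>univ := H\<rparr>)"
    and disj: "Vset F \<inter> Mset F = {}"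
    and Mstr: "is_structure L0 (Mpart (F\<lparr>univ := H\<rparr>))"
    using H(5) MH unfolding in_K_def restrict_univ[OF H(3)] isomorphic_def isomorphism_def
    by auto
  have "x \<in> insert v (Mset F)" if "x \<in> generated (ext_lang L0) F {v}" for x
    using that
  proof induction
    case (app g xs)
    then have xs: "set xs \<subseteq> insert v (Mset F)" by auto
    then have xsH: "set xs \<subseteq> H" using H(2) MH by auto
    show ?case
    proof (cases g)
      case FSym
      then obtain x y where xy: "xs = [x, y]"
        using app(2) by (auto simp: ext_lang_def numeral_2_eq_2 length_Suc_conv)
      then have "\<not> (x \<in> Vset F \<and> y \<in> Vset F \<and> x \<noteq> y)" using xs disj by auto
      then have "ff F x y = x"
        using triv xsH xy unfolding trivial_elsewhere_def restrict_univ[OF H(3)] by auto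
      then show ?thesis using FSym xy xs by auto
    next
      case (BaseF g0)
      then have g0: "g0 \<in> Fsyms L0" and len: "length xs = farity L0 g0"
        using app by (auto simp: ext_lang_def)
      show ?thesis
      \<comment> \<open>Constants fall under the first case, so the second takes \<open>hd\<close>
        of nonempty lists only.\<close>
      proof (cases "set xs \<subseteq> Mset F")
        case True
        then have "xs \<in> tuples (Mset F) (farity L0 g0)" using len by (simp add: tuples_def)
        then show ?thesis
          using Mstr g0 BaseF MH
          by (auto simp: is_structure_def Mpart_def restrict_univ[OF H(3)] Int_absorb2)
      next
        case False
        have "xs \<in> tuples H (farity L0 g0)" using len xsH by (simp add: tuples_def)
        then have "fint F g xs = hd xs"
          using triv g0 BaseF False
          unfolding trivial_elsewhere_def restrict_univ[OF H(3)] by auto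
        moreover have "hd xs \<in> set xs" using False by (cases xs) auto
        ultimately show ?thesis using xs by auto
      qed
    qed
  qed auto
  then have "H = insert v (Mset F)" using H(1,2) by blast
  then show "fg_over_M L0 F (F\<lparr>univ := insert v (Mset F)\<rparr>)"
    "in_K L0 lt M (F\<lparr>univ := insert v (Mset F)\<rparr>)" using H by auto
qed

lemma trivial_elsewhereD:
  assumes "trivial_elsewhere L0 A"
  shows "\<lbrakk>R \<in> Rsyms L0; xs \<in> tuples (univ A) (rarity L0 R); \<not> set xs \<subseteq> Mset A\<rbrakk> \<Longrightarrow>
      \<not> rint A (BaseR R) xs"
    "\<lbrakk>g \<in> Fsyms L0; xs \<in> tuples (univ A) (farity L0 g); \<not> set xs \<subseteq> Mset A\<rbrakk> \<Longrightarrow>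
      fint A (BaseF g) xs = hd xs"
    "\<lbrakk>x \<in> univ A; y \<in> univ A; \<not> (x \<in> Vset A \<and> y \<in> Vset A)\<rbrakk> \<Longrightarrow> \<not> rint A TriSym [x, y]"
    "\<lbrakk>x \<in> univ A; y \<in> univ A; \<not> (x \<in> Vset A \<and> y \<in> Vset A \<and> x \<noteq> y)\<rbrakk> \<Longrightarrow> ff A x y = x"
  using assms unfolding trivial_elsewhere_def by (blast, blast, blast, simp)

text \<open>The copy of \<open>M\<close> inside \<open>F\<close> is coded in the natural numbers by
  \<open>k\<close>, and \<open>h\<close> maps the codes back onto that copy. Since \<open>h\<close>
  need not undo \<open>k\<close>, both are exported together with \<open>T\<close>.\<close>

lemma fraisse_limit_embeds_two_point:
  fixes F :: "('a, 'f, 'r) xstruct"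
  assumes lim: "fraisse_limit L0 lt M F" and m: "m \<in> Mset F" and N: "N \<subseteq> {0, 1}"
  obtains k :: "'a \<Rightarrow> nat" and T H h where
    "inj_on k (Mset F)" "isomorphism L0 (Mpart F) T k" "univ T = k ` Mset F" "univ T \<subseteq> {2..}"
    "isomorphism (ext_lang L0) (two_point T (k m) N) (F\<lparr>univ := H\<rparr>) h"
    "Mset F \<subseteq> H" "H \<subseteq> univ F"
proof -
  have M_univ: "Mset F \<subseteq> univ F" by (auto simp: Mset_def)
  \<comment> \<open>The shift by two leaves 0 and 1 free for the two points.\<close>
  define k where "k x = Suc (Suc (to_nat_on (univ F) x))" for x
  have "countable (univ F)" using lim by (simp add: fraisse_limit_def)
  then have "inj_on k (univ F)"
    using inj_on_to_nat_on[of "univ F"] by (auto simp: k_def inj_on_def)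
  then have kinj: "inj_on k (Mset F)" using M_univ by (rule inj_on_subset)
  define T where "T = transport k (Mpart F)"
  obtain j where j: "isomorphism L0 (Mpart F) M j"
    using lim by (auto simp: fraisse_limit_def isomorphic_def)
  then have kiso: "isomorphism L0 (Mpart F) T k"
    unfolding T_def using kinj
    by (intro isomorphism_transport) (auto simp: isomorphism_def Mpart_def)
  have univT: "univ T = k ` Mset F" by (simp add: T_def transport_def Mpart_def)
  have T2: "univ T \<subseteq> {2..}" unfolding univT by (auto simp: k_def)
  have "isomorphic L0 T M"
    using isomorphism_comp[OF isomorphism_inverse[OF kiso] j] by (auto simp: isomorphic_def)
  then have "in_K L0 lt M (two_point T (k m) N)"
    using T2 N m univT by (intro in_K_two_point) auto
  moreover have "\<forall>A :: (nat, 'f, 'r) xstruct. in_K L0 lt M A \<longrightarrow>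
      (\<exists>B. fg_over_M L0 F B \<and> isomorphic (ext_lang L0) A B)"
    using lim unfolding fraisse_limit_def by (elim conjE)
  ultimately obtain B h where "fg_over_M L0 F B"
    and h: "isomorphism (ext_lang L0) (two_point T (k m) N) B h"
    unfolding isomorphic_def by blast
  then obtain A0 where A0: "A0 \<subseteq> univ F"
    and B: "B = F\<lparr>univ := generated (ext_lang L0) F A0 \<union> Mset F\<rparr>"
    unfolding fg_over_M_def by blast
  have "is_structure (ext_lang L0) F" using lim by (simp add: fraisse_limit_def)
  then have "generated (ext_lang L0) F A0 \<union> Mset F \<subseteq> univ F"
    using generated_subset_univ[OF _ A0] M_univ by auto
  then show thesis using that[OF kinj kiso univT T2 h[unfolded B]] by blast
qed

text \<open>Homogeneity moves a copy of the two-point structure inside the limit so that one of its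
  points becomes \<open>v\<close> and the value of \<open>f\<close> becomes \<open>m\<close>.\<close>

lemma fraisse_limit_two_point:
  fixes F :: "('a, 'f, 'r) xstruct"
  assumes lim: "fraisse_limit L0 lt M F" and v: "v \<in> Vset F" and m: "m \<in> Mset F"
    and i: "i \<in> {0, 1 :: nat}"
  shows "\<exists>w. w i = v \<and> w 0 \<in> Vset F \<and> w 1 \<in> Vset F \<and> (w 0, w 1) \<in> Vless F \<and>
    ff F (w 0) (w 1) = m"
proof -
  have VM: "Vset F \<subseteq> univ F" "Mset F \<subseteq> univ F" by (auto simp: Vset_def Mset_def)
  \<comment> \<open>The point with index \<open>i\<close> gets the \<open>N\<close>-status of
    \<open>v\<close>; without this the structures over \<open>v\<close> and over \<open>h i\<close>
    could fail to be isomorphic.\<close>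
  define N where "N = (if v \<in> Nset F then {i} else {})"
  have "N \<subseteq> {0, 1}" using i by (auto simp: N_def)
  then obtain k :: "'a \<Rightarrow> nat" and T H h where kinj: "inj_on k (Mset F)"
    and kiso: "isomorphism L0 (Mpart F) T k"
    and univT: "univ T = k ` Mset F" and T2: "univ T \<subseteq> {2..}"
    and h_two: "isomorphism (ext_lang L0) (two_point T (k m) N) (F\<lparr>univ := H\<rparr>) h"
    and HM: "Mset F \<subseteq> H" and H: "H \<subseteq> univ F"
    by (rule fraisse_limit_embeds_two_point[OF lim m])
  define A where "A = two_point T (k m) N"
  define B where "B = F\<lparr>univ := H\<rparr>"
  have h: "isomorphism (ext_lang L0) A B h" using h_two by (simp add: A_def B_def)
  note restr = restrict_univ[OF H]
  have univA: "univ A = {0, 1} \<union> k ` Mset F" by (simp add: A_def two_point_def univT)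
  have T01: "0 \<notin> univ T" "Suc 0 \<notin> univ T" using T2 by auto
  have VA: "Vset A = {0, 1}" and MA: "Mset A = k ` Mset F"
    using T01 by (auto simp: Vset_def Mset_def A_def two_point_def univT)
  have hV: "h ` {0, 1} = Vset F \<inter> H" and hM: "h ` k ` Mset F = Mset F"
    using isomorphism_Vset[OF h] isomorphism_Mset[OF h] HM
    unfolding VA MA B_def restr by auto
  have hinj: "inj_on h (univ A)" using h by (simp add: isomorphism_def bij_betw_def)
  define v' where "v' = h i"
  have v': "v' \<in> Vset F" using hV i unfolding v'_def by auto
  define Bv where "Bv = F\<lparr>univ := insert v (Mset F)\<rparr>"
  define Cv where "Cv = F\<lparr>univ := insert v' (Mset F)\<rparr>"
  have fgB: "fg_over_M L0 F Bv" and KB: "in_K L0 lt M Bv"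
    using fraisse_limit_fg_point[OF lim v] by (auto simp: Bv_def)
  have fgC: "fg_over_M L0 F Cv" and KC: "in_K L0 lt M Cv"
    using fraisse_limit_fg_point[OF lim v'] by (auto simp: Cv_def)
  have subB: "insert v (Mset F) \<subseteq> univ F" and subC: "insert v' (Mset F) \<subseteq> univ F"
    using v v' VM by auto
  note restrB = restrict_univ[OF subB] and restrC = restrict_univ[OF subC]
  \<comment> \<open>Disjointness is known only in substructures, so a common element is placed in
    the one that it generates.\<close>
  have disj: "Vset F \<inter> Mset F = {}"
  proof (rule ccontr)
    assume "Vset F \<inter> Mset F \<noteq> {}"
    then obtain x where x: "x \<in> Vset F" "x \<in> Mset F" by blast
    have "in_K L0 lt M (F\<lparr>univ := insert x (Mset F)\<rparr>)"
      using fraisse_limit_fg_point[OF lim x(1)] by simp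
    moreover have "insert x (Mset F) \<subseteq> univ F" using x VM by auto
    ultimately show False using x restrict_univ[of "insert x (Mset F)" F] by (auto simp: in_K_def)
  qed
  have VB: "Vset Bv = {v}" "Mset Bv = Mset F" "univ Bv = insert v (Mset F)"
    and VC: "Vset Cv = {v'}" "Mset Cv = Mset F" "univ Cv = insert v' (Mset F)"
    using v v' disj by (auto simp: restrB restrC Bv_def Cv_def)
  have vM: "v \<notin> Mset F" "v' \<notin> Mset F" using v v' disj by auto
  \<comment> \<open>On \<open>M\<close> this is the automorphism by which the embedded copy differs
    from the original. With it, an extension of \<open>g\<close> sends \<open>m\<close> to
    \<open>h (k m)\<close>, the value of \<open>f\<close> on the embedded pair.\<close>
  define g where "g x = (if x = v then v' else h (k x))" for x
  have g_v: "g v = v'" and g_M: "\<And>x. x \<in> Mset F \<Longrightarrow> g x = h (k x)" using vM by (auto simp: g_def)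
  have gM: "g ` Mset F = Mset F" using hM g_M by (auto simp: image_image)
  have g_in_M: "g x \<in> Mset F \<longleftrightarrow> x \<in> Mset F" if "x \<in> insert v (Mset F)" for x
    using that gM g_v vM by auto
  have trivB: "trivial_elsewhere L0 Bv" and trivC: "trivial_elsewhere L0 Cv"
    using KB KC by (auto simp: in_K_def)
  have fields: "fint Bv = fint F" "fint Cv = fint F" "rint Bv = rint F" "rint Cv = rint F"
    "fint B = fint F" "rint B = rint F"
    by (auto simp: Bv_def Cv_def B_def)
  have giso: "isomorphism (ext_lang L0) Bv Cv g"
    unfolding isomorphism_ext_lang VB(3) VC(3) fields
  proof (intro conjI ballI)
    show "is_structure (ext_lang L0) Bv" "is_structure (ext_lang L0) Cv"
      using KB KC by (auto simp: in_K_def)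
    have "inj_on g (Mset F)"
    proof (rule inj_onI)
      fix x y assume xy: "x \<in> Mset F" "y \<in> Mset F" "g x = g y"
      then have "k x = k y" using hinj g_M univA by (auto simp: inj_on_def)
      then show "x = y" using kinj xy by (auto simp: inj_on_def)
    qed
    then show "bij_betw g (insert v (Mset F)) (insert v' (Mset F))"
      using gM g_v vM by (auto simp: bij_betw_def)
  next
    fix g0 xs assume g0: "g0 \<in> Fsyms L0" and xs: "xs \<in> tuples (insert v (Mset F)) (farity L0 g0)"
    have gxs: "map g xs \<in> tuples (insert v' (Mset F)) (farity L0 g0)"
      using xs by (rule map_in_tuples) (use gM g_v in auto)
    show "g (fint F (BaseF g0) xs) = fint F (BaseF g0) (map g xs)"
    proof (cases "set xs \<subseteq> Mset F")
      case True
      \<comment> \<open>Inside \<open>M\<close> the map \<open>g\<close> is \<open>k\<close>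
        followed by \<open>h\<close>; the former respects the symbols of \<open>L0\<close> from the
        \<open>M\<close>-part of \<open>F\<close> to \<open>T\<close>, the latter from the two-point
        structure to \<open>F\<close>, and the two agree on \<open>T\<close>.\<close>
      then have xsM: "xs \<in> tuples (univ (Mpart F)) (farity L0 g0)"
        using xs by (simp add: tuples_def Mpart_def)
      then have kxs: "k (fint F (BaseF g0) xs) = fint T g0 (map k xs)"
        and inM: "fint F (BaseF g0) xs \<in> Mset F"
        using kiso g0 by (auto simp: isomorphism_def is_structure_def Mpart_def)
      have "map k xs \<in> tuples (univ A) (farity L0 g0)"
        using xsM by (rule map_in_tuples) (auto simp: univA Mpart_def)
      then have "h (fint A (BaseF g0) (map k xs)) = fint F (BaseF g0) (map h (map k xs))"
        using isomorphism_ext_langD(1)[OF h g0] fields by simp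
      moreover have "fint A (BaseF g0) (map k xs) = fint T g0 (map k xs)"
        using True by (auto simp: A_def two_point_def univT)
      moreover have "map g xs = map h (map k xs)" using True g_M by auto
      ultimately show ?thesis using g_M[OF inM] kxs by metis
    next
      \<comment> \<open>\<open>g\<close> preserves which arguments lie in \<open>M\<close>, so the
        normalization applies on both sides: functions return the first argument.\<close>
      case False
      then have "\<not> set (map g xs) \<subseteq> Mset F" using xs g_in_M by (auto simp: tuples_def)
      then have "fint F (BaseF g0) (map g xs) = hd (map g xs)"
        using trivial_elsewhereD(2)[OF trivC g0] gxs by (simp add: VC fields)
      moreover have "fint F (BaseF g0) xs = hd xs"
        using trivial_elsewhereD(2)[OF trivB g0] False xs by (simp add: VB fields)
      moreover have "xs \<noteq> []" using False by auto
      ultimately show ?thesis by (simp add: hd_map)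
    qed
  next
    fix R xs assume R: "R \<in> Rsyms L0" and xs: "xs \<in> tuples (insert v (Mset F)) (rarity L0 R)"
    have gxs: "map g xs \<in> tuples (insert v' (Mset F)) (rarity L0 R)"
      using xs by (rule map_in_tuples) (use gM g_v in auto)
    show "rint F (BaseR R) xs \<longleftrightarrow> rint F (BaseR R) (map g xs)"
    proof (cases "set xs \<subseteq> Mset F")
      case True
      then have xsM: "xs \<in> tuples (univ (Mpart F)) (rarity L0 R)"
        using xs by (simp add: tuples_def Mpart_def)
      then have kxs: "rint F (BaseR R) xs \<longleftrightarrow> rint T R (map k xs)"
        using kiso R by (auto simp: isomorphism_def Mpart_def)
      have "map k xs \<in> tuples (univ A) (rarity L0 R)"
        using xsM by (rule map_in_tuples) (auto simp: univA Mpart_def)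
      then have "rint A (BaseR R) (map k xs) \<longleftrightarrow> rint F (BaseR R) (map h (map k xs))"
        using isomorphism_ext_langD(3)[OF h R] fields by simp
      moreover have "rint A (BaseR R) (map k xs) \<longleftrightarrow> rint T R (map k xs)"
        using True by (auto simp: A_def two_point_def univT)
      moreover have "map g xs = map h (map k xs)" using True g_M by auto
      ultimately show ?thesis using kxs by metis
    next
      case False
      then have "\<not> set (map g xs) \<subseteq> Mset F" using xs g_in_M by (auto simp: tuples_def)
      then have "\<not> rint F (BaseR R) (map g xs)"
        using trivial_elsewhereD(1)[OF trivC R] gxs by (simp add: VC fields)
      moreover have "\<not> rint F (BaseR R) xs"
        using trivial_elsewhereD(1)[OF trivB R] False xs by (simp add: VB fields)
      ultimately show ?thesis by simp
    qed
  next
    \<comment> \<open>With one point of \<open>V\<close> there is no pair of distinct points on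
      which \<open>f\<close> or the order could be nontrivial; the pair of the point with itself is
      excluded from the order by irreflexivity.\<close>
    fix x y assume xy: "x \<in> insert v (Mset F)" "y \<in> insert v (Mset F)"
    then have gxy: "g x \<in> insert v' (Mset F)" "g y \<in> insert v' (Mset F)"
      using gM g_v by auto
    have "ff F x y = x"
      using trivial_elsewhereD(4)[OF trivB] xy by (simp add: VB fields)
    moreover have "ff F (g x) (g y) = g x"
      using trivial_elsewhereD(4)[OF trivC] gxy by (simp add: VC fields)
    ultimately show "g (ff F x y) = ff F (g x) (g y)" by simp
    have irr: "irrefl (Vless Bv)" "irrefl (Vless Cv)"
      using KB KC by (auto simp: in_K_def strict_linear_order_on_def)
    then have "\<not> rint F TriSym [v, v]" "\<not> rint F TriSym [v', v']"
      by (auto simp: irrefl_def order_on_def VB VC fields)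
    note tri = this
    have "\<not> rint F TriSym [x, y]"
      using trivial_elsewhereD(3)[OF trivB, of x y] xy tri(1) unfolding VB fields
      by (metis singletonD)
    moreover have "\<not> rint F TriSym [g x, g y]"
      using trivial_elsewhereD(3)[OF trivC, of "g x" "g y"] gxy tri(2) unfolding VC fields
      by (metis singletonD)
    ultimately show "rint F TriSym [x, y] \<longleftrightarrow> rint F TriSym [g x, g y]" by simp
  next
    fix x assume x: "x \<in> insert v (Mset F)"
    then have xF: "x \<in> univ F" and gx: "g x \<in> univ F" "g x \<in> insert v' (Mset F)"
      using gM g_v v v' VM by auto
    show "rint F MSym [x] \<longleftrightarrow> rint F MSym [g x]"
      using g_in_M[OF x] xF gx by (auto simp: Mset_def)
    have "x \<in> Vset F \<longleftrightarrow> x = v" "g x \<in> Vset F \<longleftrightarrow> g x = v'"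
      using x gx(2) v v' disj by auto
    moreover have "x = v \<longleftrightarrow> g x = v'" using g_in_M[OF x] x gx(2) vM g_v by auto
    ultimately have "x \<in> Vset F \<longleftrightarrow> g x \<in> Vset F" by simp
    then show "rint F VSym [x] \<longleftrightarrow> rint F VSym [g x]"
      using xF gx by (auto simp: Vset_def)
    \<comment> \<open>\<open>N\<close> is confined to \<open>V\<close>, so only the single point
      \<open>v\<close> can matter, and there the choice of the parameter \<open>N\<close>
      decides.\<close>
    have NM: "x \<notin> Mset F" "g x \<notin> Mset F" if "rint F NSym [x] \<or> rint F NSym [g x]"
    proof -
      have "Nset Bv \<subseteq> Vset Bv" "Nset Cv \<subseteq> Vset Cv" using KB KC by (auto simp: in_K_def)
      moreover have "x \<in> Nset Bv \<or> g x \<in> Nset Cv"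
        using that x gx(2) by (simp add: VB VC Nset_def fields)
      ultimately have "x = v \<or> g x = v'" unfolding VB VC by blast
      then show "x \<notin> Mset F" "g x \<notin> Mset F" using g_in_M[OF x] vM by auto
    qed
    have "i \<in> univ A" using i univA by auto
    then have "rint A NSym [i] \<longleftrightarrow> rint F NSym [v']"
      using isomorphism_ext_langD(6)[OF h] fields unfolding v'_def by simp
    moreover have "rint A NSym [i] \<longleftrightarrow> v \<in> Nset F" by (simp add: A_def two_point_def N_def)
    moreover have "v \<in> Nset F \<longleftrightarrow> rint F NSym [v]" using subB by (auto simp: Nset_def)
    ultimately show "rint F NSym [x] \<longleftrightarrow> rint F NSym [g x]"
      using NM x g_v by auto
  qed
  have "\<forall>B C g. fg_over_M L0 F B \<and> fg_over_M L0 F C \<and> isomorphism (ext_lang L0) B C g \<longrightarrow>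
      (\<exists>h. isomorphism (ext_lang L0) F F h \<and> (\<forall>x\<in>univ B. h x = g x))"
    using lim unfolding fraisse_limit_def by (elim conjE)
  then obtain a where a: "isomorphism (ext_lang L0) F F a"
    and ag: "\<And>x. x \<in> univ Bv \<Longrightarrow> a x = g x"
    using fgB fgC giso by blast
  \<comment> \<open>The embedded pair is pulled back along the automorphism \<open>a\<close>: from
    \<open>a v = h i\<close> follows \<open>w i = v\<close>, and from \<open>a m = h (k m)\<close>
    the value \<open>m\<close>.\<close>
  define w where "w n = inv_into (univ F) a (h n)" for n
  have aim: "a ` univ F = univ F" using isomorphism_image[OF a] .
  have ainj: "inj_on a (univ F)" using a by (simp add: isomorphism_def bij_betw_def)
  have h01: "h 0 \<in> Vset F" "h 1 \<in> Vset F" using hV by auto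
  have w: "w n \<in> univ F \<and> a (w n) = h n" if "n \<in> {0, 1}" for n
  proof -
    have "h n \<in> a ` univ F" using that h01 VM(1) aim by auto
    then show ?thesis unfolding w_def by (simp add: inv_into_into f_inv_into_f)
  qed
  have "a v = h i" using ag[of v] g_v VB(3) v'_def by simp
  moreover have "v \<in> univ F" using v VM(1) by blast
  ultimately have "w i = v" using inv_into_f_f[OF ainj, of v] by (simp add: w_def)
  moreover have wV: "w 0 \<in> Vset F" "w 1 \<in> Vset F"
    using isomorphism_ext_langD(4)[OF a] w h01 unfolding Vset_def by auto
  moreover have "(w 0, w 1) \<in> Vless F"
  proof -
    have "rint A TriSym [0, 1]" by (simp add: A_def two_point_def)
    then have "rint F TriSym [h 0, h 1]"
      using isomorphism_ext_langD(7)[OF h, of 0 1] univA fields by simp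
    then have "rint F TriSym [w 0, w 1]"
      using isomorphism_ext_langD(7)[OF a, of "w 0" "w 1"] w by simp
    then show ?thesis using wV by (simp add: order_on_def)
  qed
  moreover have "ff F (w 0) (w 1) = m"
  proof -
    have "h (ff A 0 1) = ff F (h 0) (h 1)"
      using isomorphism_ext_langD(2)[OF h, of 0 1] univA fields by simp
    moreover have "ff A 0 1 = k m" by (simp add: A_def two_point_def)
    moreover have "a m = h (k m)" using ag[of m] g_M m VB by auto
    moreover have "a (ff F (w 0) (w 1)) = ff F (h 0) (h 1)"
      using isomorphism_ext_langD(2)[OF a, of "w 0" "w 1"] w by simp
    moreover have "ff F (w 0) (w 1) \<in> univ F"
      using isomorphism_ext_langD(8)[OF a, of "w 0" "w 1"] w by simp
    moreover have "m \<in> univ F" using m VM(2) by blast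
    ultimately show ?thesis using inj_onD[OF ainj] by simp
  qed
  ultimately show ?thesis by blast
qed

section \<open>The axioms in the limit\<close>

lemma in_K_restrictD:
  assumes K: "in_K L0 lt M (S\<lparr>univ := H\<rparr>)" and H: "H \<subseteq> univ S"
  shows "strict_linear_order_on (Vset S \<inter> H) (Vless S \<inter> H \<times> H)"
    and "\<lbrakk>x \<in> Vset S \<inter> H; y \<in> Vset S \<inter> H; x \<noteq> y\<rbrakk> \<Longrightarrow>
      ff S x y = ff S y x \<and> ff S x y \<in> Mset S \<inter> H"
    and "\<lbrakk>x \<in> Vset S \<inter> H; y \<in> Vset S \<inter> H; z \<in> Vset S \<inter> H; distinct [x, y, z];
        (x, y) \<in> Vless S \<inter> H \<times> H; (y, z) \<in> Vless S \<inter> H \<times> H\<rbrakk> \<Longrightarrow>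
      ff S x y = ff S x z \<and> ff S x z = ff S y z \<or>
      ff S x y = ff S x z \<and> (ff S x z, ff S y z) \<in> Mless lt S \<inter> H \<times> H \<or>
      ff S x z = ff S y z \<and> (ff S y z, ff S x y) \<in> Mless lt S \<inter> H \<times> H"
proof -
  \<comment> \<open>The orders are rewritten first, since their left-hand sides contain the sets
    \<open>V\<close> and \<open>M\<close> of the restricted structure.\<close>
  note K = K[unfolded in_K_def restrict_univ(4,5)[OF H], unfolded restrict_univ(1-3)[OF H]]
  have fint: "fint (S\<lparr>univ := H\<rparr>) = fint S" by simp
  show "strict_linear_order_on (Vset S \<inter> H) (Vless S \<inter> H \<times> H)" using K by (elim conjE)
  show "ff S x y = ff S y x \<and> ff S x y \<in> Mset S \<inter> H"
    if "x \<in> Vset S \<inter> H" "y \<in> Vset S \<inter> H" "x \<noteq> y"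
    using K[unfolded fint] that by (elim conjE) blast
  show "ff S x y = ff S x z \<and> ff S x z = ff S y z \<or>
      ff S x y = ff S x z \<and> (ff S x z, ff S y z) \<in> Mless lt S \<inter> H \<times> H \<or>
      ff S x z = ff S y z \<and> (ff S y z, ff S x y) \<in> Mless lt S \<inter> H \<times> H"
    if "x \<in> Vset S \<inter> H" "y \<in> Vset S \<inter> H" "z \<in> Vset S \<inter> H" "distinct [x, y, z]"
      "(x, y) \<in> Vless S \<inter> H \<times> H" "(y, z) \<in> Vless S \<inter> H \<times> H"
    using K[unfolded fint] that by metis
qed

text \<open>Three sources: the universal facts about \<open>V\<close> come from members of K(M)
  inside \<open>F\<close>, the facts about the order of \<open>M\<close> from the isomorphism
  \<open>j\<close>, and the existence of points from universality and homogeneity.\<close>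

lemma fraisse_limit_valued_order:
  fixes F :: "('a, 'f, 'r) xstruct"
  assumes lim: "fraisse_limit L0 lt M F" and lt: "lt \<in> Rsyms L0" "rarity L0 lt = 2"
    and lin: "strict_linear_order_on (univ M) (order_on M lt (univ M))" and "univ M \<noteq> {}"
    and no_last: "\<forall>a\<in>univ M. \<exists>b\<in>univ M. (a, b) \<in> order_on M lt (univ M)"
  shows "valued_order (Vset F) (Vless F) (Mset F) (Mless lt F) (ff F)"
proof -
  have VM: "Vset F \<subseteq> univ F" "Mset F \<subseteq> univ F" by (auto simp: Vset_def Mset_def)
  have K: "\<exists>H. X \<subseteq> H \<and> H \<subseteq> univ F \<and> in_K L0 lt M (F\<lparr>univ := H\<rparr>)"
    if "finite X" "X \<subseteq> Vset F" for X
    using fraisse_limit_fg[OF lim that(1)] that(2) VM(1) by (metis subset_trans)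
  obtain j where j: "isomorphism L0 (Mpart F) M j"
    using lim by (auto simp: fraisse_limit_def isomorphic_def)
  have jim: "j ` Mset F = univ M" using isomorphism_image[OF j] by (simp add: Mpart_def)
  have jinj: "inj_on j (Mset F)" using j by (simp add: isomorphism_def bij_betw_def Mpart_def)
  have jlt: "(x, y) \<in> Mless lt F \<longleftrightarrow> (j x, j y) \<in> order_on M lt (univ M)"
    if "x \<in> Mset F" "y \<in> Mset F" for x y
  proof -
    have "[x, y] \<in> tuples (univ (Mpart F)) (rarity L0 lt)"
      using that lt(2) by (auto simp: tuples_2 Mpart_def)
    then have "rint (Mpart F) lt [x, y] \<longleftrightarrow> rint M lt (map j [x, y])"
      using j lt(1) unfolding isomorphism_def by blast
    then show ?thesis using that jim by (auto simp: order_on_def Mpart_def)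
  qed
  have MF: "Mless lt F \<subseteq> Mset F \<times> Mset F" and VF: "Vless F \<subseteq> Vset F \<times> Vset F"
    by (auto simp: order_on_def)
  obtain m0 where m0: "m0 \<in> Mset F" using jim assms(5) by blast
  have ext: "\<exists>w. w i = v \<and> w 0 \<in> Vset F \<and> w 1 \<in> Vset F \<and> (w 0, w 1) \<in> Vless F \<and>
    ff F (w 0) (w 1) = m" if "v \<in> Vset F" "m \<in> Mset F" "i \<in> {0, 1 :: nat}" for v m i
    using fraisse_limit_two_point[OF lim that] .
  show ?thesis
  proof
    \<comment> \<open>Universality is what makes \<open>V\<close> nonempty; the value
      \<open>m0\<close> and the empty \<open>N\<close> are arbitrary choices.\<close>
    obtain k :: "'a \<Rightarrow> nat" and T H h where
      "inj_on k (Mset F)" "isomorphism L0 (Mpart F) T k" "univ T = k ` Mset F" "univ T \<subseteq> {2..}"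
      and iso: "isomorphism (ext_lang L0) (two_point T (k m0) {}) (F\<lparr>univ := H\<rparr>) h"
      and H: "Mset F \<subseteq> H" "H \<subseteq> univ F"
      by (rule fraisse_limit_embeds_two_point[OF lim m0 empty_subsetI])
    have "0 \<in> Vset (two_point T (k m0) {})" by (simp add: Vset_def two_point_def)
    then have "h 0 \<in> Vset F \<inter> H"
      using isomorphism_Vset[OF iso] unfolding restrict_univ(1)[OF H(2)] by blast
    then show "Vset F \<noteq> {}" by blast
    show "strict_linear_order_on (Vset F) (Vless F)"
      unfolding strict_linear_order_on_def
    proof (intro conjI)
      show "trans (Vless F)"
      proof (rule transI)
        fix x y z assume xyz: "(x, y) \<in> Vless F" "(y, z) \<in> Vless F"
        then have "{x, y, z} \<subseteq> Vset F" using VF by auto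
        then obtain H where H: "{x, y, z} \<subseteq> H" "H \<subseteq> univ F" "in_K L0 lt M (F\<lparr>univ := H\<rparr>)"
          using K[of "{x, y, z}"] by auto
        have "trans (Vless F \<inter> H \<times> H)"
          using in_K_restrictD(1)[OF H(3,2)] by (simp add: strict_linear_order_on_def)
        from transD[OF this, of x y z] show "(x, z) \<in> Vless F" using xyz H(1) by auto
      qed
      show "irrefl (Vless F)"
      proof (rule irreflI, rule notI)
        fix x assume x: "(x, x) \<in> Vless F"
        then have "{x} \<subseteq> Vset F" using VF by auto
        then obtain H where H: "{x} \<subseteq> H" "H \<subseteq> univ F" "in_K L0 lt M (F\<lparr>univ := H\<rparr>)"
          using K[of "{x}"] by auto
        have "irrefl (Vless F \<inter> H \<times> H)"
          using in_K_restrictD(1)[OF H(3,2)] by (simp add: strict_linear_order_on_def)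
        then show False using x H(1) by (auto simp: irrefl_def)
      qed
      show "total_on (Vset F) (Vless F)"
      proof (rule total_onI)
        fix x y assume xy: "x \<in> Vset F" "y \<in> Vset F" "x \<noteq> y"
        then obtain H where H: "{x, y} \<subseteq> H" "H \<subseteq> univ F" "in_K L0 lt M (F\<lparr>univ := H\<rparr>)"
          using K[of "{x, y}"] by auto
        have "total_on (Vset F \<inter> H) (Vless F \<inter> H \<times> H)"
          using in_K_restrictD(1)[OF H(3,2)] by (simp add: strict_linear_order_on_def)
        then show "(x, y) \<in> Vless F \<or> (y, x) \<in> Vless F" using xy H(1) by (auto simp: total_on_def)
      qed
    qed
    show "strict_linear_order_on (Mset F) (Mless lt F)"
      unfolding strict_linear_order_on_def
    proof (intro conjI)
      have tr: "trans (order_on M lt (univ M))" and irr: "irrefl (order_on M lt (univ M))"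
        and tot: "total_on (univ M) (order_on M lt (univ M))"
        using lin by (auto simp: strict_linear_order_on_def)
      show "trans (Mless lt F)"
      proof (rule transI)
        fix x y z assume xyz: "(x, y) \<in> Mless lt F" "(y, z) \<in> Mless lt F"
        then have "x \<in> Mset F" "y \<in> Mset F" "z \<in> Mset F" using MF by auto
        then show "(x, z) \<in> Mless lt F" using xyz jlt transD[OF tr] by blast
      qed
      show "irrefl (Mless lt F)" using irr jlt MF unfolding irrefl_def by blast
      show "total_on (Mset F) (Mless lt F)"
      proof (rule total_onI)
        fix x y assume xy: "x \<in> Mset F" "y \<in> Mset F" "x \<noteq> y"
        then have "j x \<noteq> j y" "j x \<in> univ M" "j y \<in> univ M" using jinj jim by (auto simp: inj_on_def)
        then show "(x, y) \<in> Mless lt F \<or> (y, x) \<in> Mless lt F"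
          using tot jlt xy unfolding total_on_def by blast
      qed
    qed
    show "\<exists>n\<in>Mset F. (m, n) \<in> Mless lt F" if "m \<in> Mset F" for m
    proof -
      have "j m \<in> univ M" using that jim by auto
      then obtain b where b: "b \<in> univ M" "(j m, b) \<in> order_on M lt (univ M)" using no_last by blast
      then obtain n where n: "n \<in> Mset F" "b = j n" unfolding jim[symmetric] by blast
      then have "(m, n) \<in> Mless lt F" using jlt[OF that n(1)] b(2) by simp
      then show ?thesis using n(1) by blast
    qed
  next
    fix x y assume xy: "x \<in> Vset F" "y \<in> Vset F" "x \<noteq> y"
    then obtain H where H: "{x, y} \<subseteq> H" "H \<subseteq> univ F" "in_K L0 lt M (F\<lparr>univ := H\<rparr>)"
      using K[of "{x, y}"] by auto
    then show "ff F x y = ff F y x" "ff F x y \<in> Mset F"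
      using in_K_restrictD(2)[OF H(3,2), of x y] xy by auto
  next
    fix x y z assume V: "x \<in> Vset F" "y \<in> Vset F" "z \<in> Vset F"
      and xyz: "(x, y) \<in> Vless F" "(y, z) \<in> Vless F"
    then obtain H where H: "{x, y, z} \<subseteq> H" "H \<subseteq> univ F" "in_K L0 lt M (F\<lparr>univ := H\<rparr>)"
      using K[of "{x, y, z}"] by auto
    have tr: "trans (Vless F \<inter> H \<times> H)" and irr: "\<And>u. (u, u) \<notin> Vless F \<inter> H \<times> H"
      using in_K_restrictD(1)[OF H(3,2)] unfolding strict_linear_order_on_def irrefl_def by blast+
    have xyzH: "(x, y) \<in> Vless F \<inter> H \<times> H" "(y, z) \<in> Vless F \<inter> H \<times> H" using xyz H(1) by auto
    then have d: "distinct [x, y, z]" using irr transD[OF tr xyzH] by auto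
    show "ff F x y = ff F x z \<and> ff F x z = ff F y z \<or>
        ff F x y = ff F x z \<and> (ff F x z, ff F y z) \<in> Mless lt F \<or>
        ff F x z = ff F y z \<and> (ff F y z, ff F x y) \<in> Mless lt F"
      using in_K_restrictD(3)[OF H(3,2) _ _ _ d xyzH] V H(1) by blast
  next
    fix v m assume vm: "v \<in> Vset F" "m \<in> Mset F"
    \<comment> \<open>Placing \<open>v\<close> as the upper point of the pair (index 1) gives a
      point below it, as the lower point (index 0) a point above it.\<close>
    show "\<exists>w\<in>Vset F. (w, v) \<in> Vless F \<and> ff F w v = m" using ext[OF vm, of 1] by auto
    show "\<exists>w\<in>Vset F. (v, w) \<in> Vless F \<and> ff F v w = m" using ext[OF vm, of 0] by auto
  qed
qed

section \<open>From the limit to arbitrary models of its Scott sentence\<close>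

lemma model_valued_order:
  fixes F :: "('a, 'f, 'r) xstruct" and G :: "('g, 'f, 'r) xstruct"
  assumes "countable_lang L0" and lt: "lt \<in> Rsyms L0" "rarity L0 lt = 2"
    and F: "valued_order (Vset F) (Vless F) (Mset F) (Mless lt F) (ff F)"
    and scott: "scott_sentence (ext_lang L0) F \<psi>" and G: "is_model (ext_lang L0) G \<psi>"
  shows "valued_order (Vset G) (Vless G) (Mset G) (Mless lt G) (ff G)"
proof (rule valued_order_local)
  fix X assume X: "finite X" "X \<subseteq> Vset G \<union> Mset G"
  have sent: "sentence (ext_lang L0) \<psi>" using scott by (simp add: scott_sentence_def)
  have "countable (Fsyms (ext_lang L0))"
    using assms(1) by (simp add: countable_lang_def ext_lang_def)
  moreover have "X \<subseteq> univ G" using X(2) by (auto simp: Vset_def Mset_def)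
  ultimately obtain H where H: "X \<subseteq> H" "H \<subseteq> univ G" "countable H"
    and model: "is_model (ext_lang L0) (G\<lparr>univ := H\<rparr>) \<psi>"
    using downward_loewenheim_skolem[OF G sent _ countable_finite[OF X(1)]] by blast
  let ?G = "G\<lparr>univ := H\<rparr>"
  \<comment> \<open>The Scott sentence speaks of structures on natural numbers, so the countable
    piece of \<open>G\<close> is copied there; the axioms then travel back from \<open>F\<close>
    through this copy to the piece.\<close>
  let ?T = "transport (to_nat_on H) ?G"
  have iso: "isomorphism (ext_lang L0) ?G ?T (to_nat_on H)"
  proof (rule isomorphism_transport)
    show "is_structure (ext_lang L0) ?G" using model by (simp add: is_model_def)
    show "inj_on (to_nat_on H) (univ ?G)" using inj_on_to_nat_on[OF H(3)] by simp
  qed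
  have "is_structure (ext_lang L0) ?T" using iso by (simp add: isomorphism_def)
  moreover have "is_model (ext_lang L0) ?T \<psi>" using is_model_isomorphism[OF iso sent model] .
  ultimately obtain h where "isomorphism (ext_lang L0) ?T F h"
    using scott unfolding scott_sentence_def isomorphic_def by blast
  from valued_order_isomorphism[OF iso lt valued_order_isomorphism[OF this lt F]]
  have "valued_order (Vset ?G) (Vless ?G) (Mset ?G) (Mless lt ?G) (ff ?G)" .
  moreover have "ff ?G = ff G" by simp
  ultimately have "valued_order (Vset G \<inter> H) (Vless G \<inter> H \<times> H) (Mset G \<inter> H)
      (Mless lt G \<inter> H \<times> H) (ff G)"
    unfolding restrict_univ(4,5)[OF H(2)] unfolding restrict_univ(1,2)[OF H(2)] by simp
  then show "\<exists>H. X \<subseteq> H \<and> valued_order (Vset G \<inter> H) (Vless G \<inter> H \<times> H) (Mset G \<inter> H)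
      (Mless lt G \<inter> H \<times> H) (ff G)"
    using H(1) by blast
qed (auto simp: order_on_def)

theorem theorem5p1:
  fixes L0 :: "('f, 'r) lang" and lt :: 'r and M :: "('m, 'f, 'r) struct"
    and \<phi> :: "('f, 'r) fm" and \<kappa> :: "'c rel"
    and F :: "('a, 'f, 'r) xstruct" and \<phi>\<^sub>F :: "('f xfun, 'r xrel) fm"
    and G :: "('g, 'f, 'r) xstruct"
  assumes "countable_lang L0" and "lt \<in> Rsyms L0" and "rarity L0 lt = 2"
    and "is_structure L0 M" and "countable (univ M)"
    and "dense_linear_ordering (univ M) (order_on M lt (univ M))"
    and no_last: "\<forall>a\<in>univ M. \<exists>b\<in>univ M. (a, b) \<in> order_on M lt (univ M)"
    and "Card_order \<kappa>" and "natLeq <o \<kappa>"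
    and "scott_sentence L0 M \<phi>" and "characterizes L0 \<phi> \<kappa>"
    and "fraisse_limit L0 lt M F"
    and "scott_sentence (ext_lang L0) F \<phi>\<^sub>F"
    and "is_model (ext_lang L0) G \<phi>\<^sub>F"
  shows "dense_linear_ordering (Vset G) (Vless G) \<and>
         character (Vset G) (Vless G) =o cofinality (Mset G) (Mless lt G)"
proof -
  have "strict_linear_order_on (univ M) (order_on M lt (univ M))" "univ M \<noteq> {}"
    using assms(6) by (auto simp: dense_linear_ordering_def)
  note F = fraisse_limit_valued_order[OF assms(12,2,3) this no_last]
  interpret G: valued_order "Vset G" "Vless G" "Mset G" "Mless lt G" "ff G"
    by (rule model_valued_order[OF assms(1-3) F assms(13,14)])
  show ?thesis using G.dense G.character_ordIso_cofinality by blast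
qed

end
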